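(* For every integer $n \ge 0$, let $p_{2,2}(n)$ be the number of partitions $\lambda$ of $n$ with $\mathrm{mex}_{2,2}(\lambda) \equiv 2 \pmod 4$. Then $p_{2,2}(n)$ equals the number of partitions of $n$ with even rerank.
   Context: A partition of $n$ is a finite weakly decreasing sequence of positive integers (its parts) with sum $n$; the empty partition $\emptyset$ is the only partition of $0$. Partitions are identified with their Ferrers diagrams, whose cells have matrix coordinates $(i,j)$ (row $i$, column $j$). $\mathrm{mex}_{2,2}(\lambda)$ is the smallest positive even integer that is not a part of $\lambda$. Frobenius representation: if the main diagonal of $\lambda$ consists of the $d$ cells $(i,i)$, $1 \le i \le d$, let $x_i$ be the number of cells in row $i$ strictly to the right of $(i,i)$ and $y_i$ the number of cells in column $i$ strictly below $(i,i)$; then $F(\lambda) = (x_1,\dots,x_d \mid y_1,\dots,y_d)$. A rim hook is an edgewise connected skew diagram containing no $2\times 2$ block of cells; its length is its number of cells, and its arm length is one less than the number of columns it occupies. The rim of a diagram is the rim hook consisting of all cells along its south-east border, i.e. of all cells $(i,j)$ of the diagram such that $(i+1,j+1)$ is not in the diagram. Definition of $\mathrm{rerank}(\lambda)$: (1) Let $D_1(\lambda)$ be the largest rectangle contained in $\lambda$ with a corner at cell $(1,1)$ whose horizontal side length exceeds its vertical side length by one, and let $n_1$ be its vertical side length (so $n_1=\max\{m\ge 0: m=0 \text{ or } \lambda_m \ge m+1\}$). Let $A_1(\lambda)$ be the sub-diagram of $\lambda$ consisting of the cells in the first $n_1$ rows but not in $D_1(\lambda)$, regarded as the partition $(\lambda_1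 - n_1 - 1, \dots, \lambda_{n_1} - n_1 - 1)$ with zeros omitted. If $\lambda=\emptyset$ or all parts of $\lambda$ are $1$, then $D_1(\lambda)=A_1(\lambda)=\emptyset$ and $n_1=0$. (2) From the diagram $A_1(\lambda)$ strip away the longest of the rightmost rim hooks with arm length $n_1+1$ lying along the rim of the diagram (that is, remove all rim cells lying in the rightmost $n_1+2$ columns of the diagram). Repeat the same procedure until the remaining diagram has less than $n_1+2$ columns. Call the residual diagram $R_1(\lambda)$. (3) Let $F(R_1(\lambda)) = (x_1,\dots,x_d \mid y_1,\dots,y_d)$ (with $d=0$ if $R_1(\lambda)=\emptyset$), set $y_0 = n_1$ and $x_{d+1} = -1$, and define $$\mathrm{rerank}(\lambda) = \max_{0 \le i \le d} (y_i - x_{i+1}) - 1 .$$ *)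

theory Defs
  imports Main "HOL-Library.While_Combinator"
begin

text \<open>Partitions are weakly decreasing lists of positive parts. The \<open>i\<close>-th part
  \<open>\<lambda>\<^sub>i\<close> (counted from 1) is the list element with index \<open>i - 1\<close>.\<close>

definition partitions :: "nat \<Rightarrow> nat list set" where
  "partitions n = {xs. sorted_wrt (\<ge>) xs \<and> (\<forall>x\<in>set xs. 0 < x) \<and> sum_list xs = n}"

definition mex22 :: "nat list \<Rightarrow> nat" where
  "mex22 xs = (LEAST m. 0 < m \<and> even m \<and> m \<notin> set xs)"

definition p22 :: "nat \<Rightarrow> nat" where
  "p22 n = card {xs \<in> partitions n. mex22 xs mod 4 = 2}"

text \<open>A cell is a pair (row, column), both counted from 1.\<close>

definition diagram :: "nat list \<Rightarrow> (nat \<times> nat) set" where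
  "diagram xs = (SIGMA i:{1..length xs}. {1..xs ! (i - 1)})"

definition num_columns :: "(nat \<times> nat) set \<Rightarrow> nat" where
  "num_columns S = card (snd ` S)"

definition rim :: "(nat \<times> nat) set \<Rightarrow> (nat \<times> nat) set" where
  "rim S = {c \<in> S. (fst c + 1, snd c + 1) \<notin> S}"

text \<open>The rectangle \<open>D\<^sub>1\<close> is the \<open>n\<^sub>1\<close> by \<open>n\<^sub>1 + 1\<close> one in the top left corner. The case
  \<open>m = 0\<close> below is the empty rectangle.\<close>

definition n1 :: "nat list \<Rightarrow> nat" where
  "n1 xs = Max {m. {1..m} \<times> {1..m + 1} \<subseteq> diagram xs}"

definition A1 :: "nat list \<Rightarrow> nat list" where
  "A1 xs = filter (\<lambda>x. 0 < x) (map (\<lambda>x. x - (n1 xs + 1)) (take (n1 xs) xs))"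

text \<open>One stripping step for arm length \<open>a\<close>, used on diagrams with at least \<open>a + 1\<close> columns:
  the longest rightmost rim hook of arm length \<open>a\<close> consists of all rim cells in the last
  \<open>a + 1\<close> columns, i.e. in the columns with number greater than
  \<open>num_columns S - (a + 1)\<close>.\<close>

definition strip_rim_hook :: "nat \<Rightarrow> (nat \<times> nat) set \<Rightarrow> (nat \<times> nat) set" where
  "strip_rim_hook a S = S - {c \<in> rim S. num_columns S < snd c + (a + 1)}"

text \<open>The loop terminates, since every step removes the whole last column.\<close>

definition R1 :: "nat list \<Rightarrow> (nat \<times> nat) set" where
  "R1 xs = while (\<lambda>S. n1 xs + 2 \<le> num_columns S) (strip_rim_hook (n1 xs + 1)) (diagram (A1 xs))"

text \<open>Frobenius representation \<open>(x\<^sub>1, \<dots>, x\<^sub>d | y\<^sub>1, \<dots>, y\<^sub>d)\<close> of a diagram.\<close>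

definition frob_d :: "(nat \<times> nat) set \<Rightarrow> nat" where
  "frob_d S = card {c \<in> S. fst c = snd c}"

definition frob_x :: "(nat \<times> nat) set \<Rightarrow> nat \<Rightarrow> nat" where
  "frob_x S i = card {c \<in> S. fst c = i \<and> i < snd c}"

definition frob_y :: "(nat \<times> nat) set \<Rightarrow> nat \<Rightarrow> nat" where
  "frob_y S i = card {c \<in> S. snd c = i \<and> i < fst c}"

definition rerank :: "nat list \<Rightarrow> int" where
  "rerank xs =
    (let R = R1 xs; d = frob_d R;
         x = (\<lambda>i. if i = d + 1 then - 1 else int (frob_x R i));
         y = (\<lambda>i. if i = 0 then int (n1 xs) else int (frob_y R i))
     in (MAX i\<in>{0..d}. y i - x (i + 1)) - 1)"

end

theory Submission
  imports Defs "HOL-Library.Multiset"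
begin

text \<open>
  On the partitions of \<open>n\<close>, the value \<open>r\<close> of the rerank is taken exactly as often as the value
  \<open>2 * r + 2\<close> of the excludant, and the latter number is \<open>2\<close> modulo \<open>4\<close> if and only if \<open>r\<close> is even.
  It is enough to compare the tails of the two distributions. The excludant is at least
  \<open>2 * r + 2\<close> if and only if \<open>2, 4, \<dots>, 2 * r\<close> are parts; without one copy of each of them an
  arbitrary partition of \<open>n - r * (r + 1)\<close> remains (\<open>card_le_mex22\<close>). The main point is that the
  partitions of \<open>n\<close> with rerank at least \<open>r\<close> are also as numerous as the partitions of
  \<open>n - r * (r + 1)\<close> (\<open>card_le_rerank\<close>).

  For any \<open>d > 0\<close>, cut a partition along its largest corner rectangle with \<open>k\<close> rows and \<open>k + d\<close>
  columns. To its right there is a partition with at most \<open>k\<close> rows, below it one with parts at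
  most \<open>k + d\<close>. Strip rim hooks of arm length \<open>k + d\<close> from the right partition until at most
  \<open>k + d\<close> columns remain. The hook lengths lie between \<open>k + d + 1\<close> and \<open>2 * k + d\<close>, they are
  removed in weakly increasing order, and each pair of a residue in the \<open>k\<close> by \<open>k + d\<close> box and a
  multiset of such lengths arises exactly once (\<open>bij_betw_strip\<close>). Together with the parts below
  the rectangle, the lengths form an arbitrary partition with parts at most \<open>2 * k + d\<close>. Hence
  partitions correspond to triples of a number \<open>k\<close>, a Frobenius symbol in the \<open>k\<close> by \<open>k + d\<close> box
  and a partition with parts at most \<open>2 * k + d\<close> (\<open>bij_betw_durfee_code\<close>).

  For \<open>d = 1\<close> the rerank is a function of \<open>k\<close> and the Frobenius symbol: it is at least \<open>r\<close> if and
  only if \<open>y\<^sub>i - x\<^sub>i\<^sub>+\<^sub>1 > r\<close> for some \<open>i\<close>. At the first such \<open>i\<close> a reflection is possible: add \<open>r\<close>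
  to the arms and subtract \<open>r\<close> from the legs up to \<open>i\<close>, and exchange arms and legs after \<open>i\<close>. This
  keeps the size and maps the symbols in question bijectively onto all symbols in the \<open>k - r\<close> by
  \<open>k + r + 1\<close> box (\<open>reflect_correct\<close>, \<open>unreflect_correct\<close>). This box belongs to a rectangle with
  \<open>k - r\<close> rows and \<open>d = 2 * r + 1\<close>, for which the bound \<open>2 * k + 1\<close> on the third component is the
  same, and whose area is smaller by \<open>r * (r + 1)\<close>. Reading the new triple as the code of
  a partition for this value of \<open>d\<close> completes the correspondence.
\<close>

section \<open>Partitions with bounded parts and their conjugates\<close>

definition parts_upto :: "nat \<Rightarrow> nat list set" where
  "parts_upto k = {xs. sorted_wrt (\<ge>) xs \<and> set xs \<subseteq> {1..k}}"

text \<open>Rim hooks are removed from right to left, so the partition to be stripped is handled as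
  the list of its column heights. A height may be \<open>0\<close>; such a column has no cells.\<close>

definition column_diagram :: "nat list \<Rightarrow> (nat \<times> nat) set" where
  "column_diagram cs = {(i, j). 1 \<le> j \<and> j \<le> length cs \<and> 1 \<le> i \<and> i \<le> cs ! (j - 1)}"

lemma parts_upto_Nil [simp]: "[] \<in> parts_upto k"
  by (simp add: parts_upto_def)

lemma parts_upto_Cons:
  "c # cs \<in> parts_upto k \<longleftrightarrow> 0 < c \<and> c \<le> k \<and> cs \<in> parts_upto c"
  by (auto simp: parts_upto_def)

lemma parts_upto_mono: "j \<le> k \<Longrightarrow> parts_upto j \<subseteq> parts_upto k"
  by (auto simp: parts_upto_def)

text \<open>Putting a longest row on top of a diagram makes every old column one cell higher and adds
  columns of height \<open>1\<close>.\<close>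

fun conjugate :: "nat list \<Rightarrow> nat list" where
  "conjugate [] = []"
| "conjugate (x # xs) =
     map Suc (conjugate xs) @ replicate (x - length (conjugate xs)) 1"

lemma length_conjugate_le: "xs \<in> parts_upto k \<Longrightarrow> length (conjugate xs) \<le> k"
  by (induction xs arbitrary: k) (auto simp: parts_upto_Cons)

lemma sorted_wrt_replicate: "sorted_wrt (\<ge>) (replicate t (x :: nat))"
  by (induction t) auto

lemma conjugate_in_parts_upto:
  "xs \<in> parts_upto k \<Longrightarrow> conjugate xs \<in> parts_upto (length xs)"
proof (induction xs arbitrary: k)
  case (Cons x xs)
  then have "conjugate xs \<in> parts_upto (length xs)"
    by (auto simp: parts_upto_Cons)
  then show ?case
    by (auto simp: parts_upto_def sorted_wrt_append sorted_wrt_map sorted_wrt_replicate)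
qed simp

lemma sum_conjugate: "xs \<in> parts_upto k \<Longrightarrow> sum_list (conjugate xs) = sum_list xs"
proof (induction xs arbitrary: k)
  case (Cons x xs)
  then show ?case
    using length_conjugate_le[of xs x]
    by (auto simp: parts_upto_Cons sum_list_Suc[of "\<lambda>x. x", simplified] sum_list_replicate)
qed simp

text \<open>The recursion of \<open>conjugate\<close> describes a new first row. This is its mirror image for a new
  first column, from which it follows that conjugation is an involution.\<close>

lemma conjugate_add_row:
  assumes "zs \<noteq> [] \<or> 0 < t" "zs \<in> parts_upto k"
  shows "conjugate (map Suc zs @ replicate t 1) = (length zs + t) # conjugate zs"
  using assms
proof (induction zs arbitrary: k)
  case Nil
  have "conjugate (replicate (Suc u) 1) = [Suc u]" for u
    by (induction u) auto
  with Nil show ?case by (cases t) simp_all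
next
  case (Cons z zs)
  show ?case
  proof (cases "zs = [] \<and> t = 0")
    case True
    with Cons.prems show ?thesis by (cases z) (auto simp: parts_upto_Cons)
  next
    case False
    with Cons.prems have "conjugate (map Suc zs @ replicate t 1) = (length zs + t) # conjugate zs"
      by (intro Cons.IH) (auto simp: parts_upto_Cons)
    then show ?thesis by simp
  qed
qed

lemma conjugate_conjugate: "xs \<in> parts_upto k \<Longrightarrow> conjugate (conjugate xs) = xs"
proof (induction xs arbitrary: k)
  case (Cons x xs)
  have le: "length (conjugate xs) \<le> x" and IH: "conjugate (conjugate xs) = xs"
    and mem: "conjugate xs \<in> parts_upto (length xs)" and "0 < x"
    using Cons length_conjugate_le[of xs x] conjugate_in_parts_upto[of xs x]
    by (auto simp: parts_upto_Cons)
  then have "conjugate xs \<noteq> [] \<or> 0 < x - length (conjugate xs)" by auto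
  from conjugate_add_row[OF this mem] le IH show ?case by simp
qed simp

lemma mem_diagram:
  "(Suc i, Suc j) \<in> diagram xs \<longleftrightarrow> i < length xs \<and> j < xs ! i"
  by (auto simp: diagram_def)

lemma mem_column_diagram:
  "(Suc i, Suc j) \<in> column_diagram cs \<longleftrightarrow> j < length cs \<and> i < cs ! j"
  by (auto simp: column_diagram_def)

text \<open>All cells have positive coordinates, so diagrams may be compared on successors only; there
  the one-based cell coordinates match the zero-based list indices.\<close>

lemma cell_set_eqI:
  fixes S T :: "(nat \<times> nat) set"
  assumes "\<And>p. p \<in> S \<Longrightarrow> 0 < fst p \<and> 0 < snd p" "\<And>p. p \<in> T \<Longrightarrow> 0 < fst p \<and> 0 < snd p"
    and "\<And>i j. (Suc i, Suc j) \<in> S \<longleftrightarrow> (Suc i, Suc j) \<in> T"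
  shows "S = T"
proof (rule set_eqI)
  fix p :: "nat \<times> nat"
  obtain i j where p: "p = (i, j)" by (cases p)
  show "p \<in> S \<longleftrightarrow> p \<in> T"
    using assms(1,2)[of p] assms(3)[of "i - 1" "j - 1"] unfolding p by (cases i; cases j) auto
qed

lemma column_diagram_pos: "p \<in> column_diagram cs \<Longrightarrow> 0 < fst p \<and> 0 < snd p"
  by (auto simp: column_diagram_def)

lemma diagram_pos: "p \<in> diagram cs \<Longrightarrow> 0 < fst p \<and> 0 < snd p"
  by (auto simp: diagram_def)

lemma column_diagram_conjugate:
  assumes "xs \<in> parts_upto k"
  shows "column_diagram (conjugate xs) = diagram xs"
proof (rule cell_set_eqI)
  show "(Suc i, Suc j) \<in> column_diagram (conjugate xs) \<longleftrightarrow> (Suc i, Suc j) \<in> diagram xs" for i j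
    using assms unfolding mem_diagram mem_column_diagram
  proof (induction xs arbitrary: i k)
    case (Cons x xs)
    have "length (conjugate xs) \<le> x" and mem: "xs \<in> parts_upto x"
      using Cons.prems length_conjugate_le[of xs x] by (auto simp: parts_upto_Cons)
    then show ?case
      using Cons.IH[OF mem, of "i - 1"] by (cases i) (auto simp: nth_append)
  qed simp
qed (auto dest: column_diagram_pos diagram_pos)

section \<open>Stripping rim hooks column by column\<close>

text \<open>The columns are read from the last one to the first. The window \<open>ws\<close> contains the \<open>l\<close>
  rightmost columns of what is left, padded with zeros on the right. As long as there is a zero,
  the diagram to the right of the current position has fewer than \<open>l\<close> columns and the next column
  is shifted in. If there is none, the next column, of height \<open>c\<close>, is the first of \<open>l + 1\<close>
  columns, and a rim hook of arm length \<open>l\<close> goes away: the column of height \<open>c\<close> disappears and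
  the \<open>l\<close> columns after it lose one cell each. This hook has \<open>c + l\<close> cells; the second component
  records \<open>c\<close>.\<close>

fun strip :: "nat \<Rightarrow> nat list \<Rightarrow> nat list \<times> nat list" where
  "strip l [] = (replicate l 0, [])"
| "strip l (c # cs) =
     (let (ws, hs) = strip l cs in
      if last ws = 0 then (c # butlast ws, hs) else (map (\<lambda>w. w - 1) ws, c # hs))"

text \<open>Column lists of the partitions with at most \<open>k\<close> rows and at most \<open>l\<close> columns, padded with
  zeros to length \<open>l\<close>.\<close>

definition box :: "nat \<Rightarrow> nat \<Rightarrow> nat list set" where
  "box l k = {ws. length ws = l \<and> sorted_wrt (\<ge>) ws \<and> set ws \<subseteq> {..k}}"

lemma box_mono: "j \<le> k \<Longrightarrow> box l j \<subseteq> box l k"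
  by (auto simp: box_def)

lemma sorted_wrt_ge_last: "sorted_wrt (\<ge>) ws \<Longrightarrow> w \<in> set ws \<Longrightarrow> last ws \<le> (w::nat)"
  by (induction ws) auto

lemma box_dec: "ws \<in> box l k \<Longrightarrow> map (\<lambda>w. w - 1) ws \<in> box l (k - 1)"
  by (auto simp: box_def sorted_wrt_map intro: sorted_wrt_mono_rel[rotated])

lemma box_pull:
  assumes "ws \<in> box l c" "0 < l" shows "c # butlast ws \<in> box l c"
proof -
  have "sorted_wrt (\<ge>) (butlast ws)"
    using assms by (metis (mono_tags, lifting) box_def butlast_conv_take mem_Collect_eq sorted_wrt_take)
  with assms show ?thesis by (auto simp: box_def dest: in_set_butlastD)
qed

lemma strip_in:
  assumes "0 < l"
  shows "cs \<in> parts_upto k \<Longrightarrow> strip l cs \<in> box l k \<times> parts_upto k"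
proof (induction cs arbitrary: k)
  case Nil then show ?case by (auto simp: box_def sorted_wrt_replicate)
next
  case (Cons c cs)
  obtain ws hs where s: "strip l cs = (ws, hs)" by fastforce
  have c: "0 < c" "c \<le> k" and "cs \<in> parts_upto c" using Cons.prems by (auto simp: parts_upto_Cons)
  from Cons.IH[OF this(3)] s have mem: "ws \<in> box l c" "hs \<in> parts_upto c" by auto
  have dec: "map (\<lambda>w. w - 1) ws \<in> box l k"
    using box_dec[OF mem(1)] box_mono[of "c - 1" k l] c by (meson diff_le_self le_trans subsetD)
  show ?case
    using c mem dec box_pull[OF mem(1) assms] box_mono[of c k l]
      parts_upto_mono[of c k] s
    by (auto simp: parts_upto_Cons)
qed

lemma box_last_pos: "ws \<in> box l k \<Longrightarrow> last ws \<noteq> 0 \<Longrightarrow> w \<in> set ws \<Longrightarrow> 0 < w"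
  using sorted_wrt_ge_last[of ws w] by (auto simp: box_def)

lemma sum_list_dec:
  "\<forall>w\<in>set ws. 0 < w \<Longrightarrow> sum_list (map (\<lambda>w. w - 1) ws) + length ws = sum_list (ws :: nat list)"
  by (induction ws) auto

text \<open>No cell is lost: a recorded column \<open>c\<close> accounts for a hook of \<open>c + l\<close> cells.\<close>

lemma sum_strip:
  assumes "0 < l" "cs \<in> parts_upto k" "strip l cs = (ws, hs)"
  shows "sum_list cs = sum_list ws + sum_list hs + l * length hs"
  using assms(2,3)
proof (induction cs arbitrary: k ws hs)
  case Nil then show ?case by (auto simp: sum_list_replicate)
next
  case (Cons c cs)
  obtain us gs where s: "strip l cs = (us, gs)" by fastforce
  have cs: "cs \<in> parts_upto c" using Cons.prems by (auto simp: parts_upto_Cons)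
  have us: "us \<in> box l c" using strip_in[OF assms(1) cs] s by auto
  then have ne: "us \<noteq> []" using assms(1) by (auto simp: box_def)
  have IH: "sum_list cs = sum_list us + sum_list gs + l * length gs"
    by (rule Cons.IH[OF cs s])
  show ?case
  proof (cases "last us = 0")
    case True
    have "sum_list us = sum_list (butlast us) + last us"
      by (subst append_butlast_last_id[OF ne, symmetric], subst sum_list_append) simp
    with True IH s Cons.prems show ?thesis by auto
  next
    case False
    then have "sum_list (map (\<lambda>w. w - 1) us) + l = sum_list us"
      using sum_list_dec[of us] box_last_pos[OF us] us by (auto simp: box_def)
    with False IH s Cons.prems show ?thesis by auto
  qed
qed

lemma strip_Cons_neq:
  assumes "0 < l" "0 < c" shows "strip l (c # cs) \<noteq> strip l []"
proof -
  obtain ws hs where "strip l cs = (ws, hs)" by fastforce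
  then show ?thesis using assms by (cases l) auto
qed

text \<open>The last step can be recognised from the result. If the column \<open>c\<close> was shifted in, the
  window starts with \<open>c\<close>, and no recorded value exceeds \<open>c\<close>. If a hook was removed, the latest
  recorded value is \<open>c\<close>, and the window entries, having been at most \<open>c\<close>, have dropped below it.\<close>

lemma strip_inj:
  assumes "0 < l"
  shows "\<lbrakk>cs \<in> parts_upto k; ds \<in> parts_upto k; strip l cs = strip l ds\<rbrakk> \<Longrightarrow> cs = ds"
proof (induction cs arbitrary: ds k)
  case Nil
  then show ?case using strip_Cons_neq[OF assms] by (cases ds) (auto simp: parts_upto_Cons simp del: strip.simps)
next
  case (Cons c cs ds')
  obtain d ds where ds': "ds' = d # ds"
    using Cons.prems strip_Cons_neq[OF assms] by (cases ds') (auto simp: parts_upto_Cons simp del: strip.simps)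
  obtain us gs vs hs where s: "strip l cs = (us, gs)" "strip l ds = (vs, hs)" by fastforce
  have cs: "cs \<in> parts_upto c" "ds \<in> parts_upto d" "0 < c" "0 < d"
    using Cons.prems by (auto simp: ds' parts_upto_Cons)
  have b: "us \<in> box l c" "gs \<in> parts_upto c" "vs \<in> box l d" "hs \<in> parts_upto d"
    using strip_in[OF assms cs(1)] strip_in[OF assms cs(2)] s by auto
  then have ne: "us \<noteq> []" "vs \<noteq> []" using assms by (auto simp: box_def)
  have eq: "strip l (c # cs) = strip l (d # ds)" using Cons.prems ds' by simp
  \<comment> \<open>A shift and a hook removal cannot lead to the same result.\<close>
  have bb: "False" if "last (vs::nat list) \<noteq> 0" "c # butlast us = map (\<lambda>w. w - 1) vs" "gs = d # hs"
      "vs \<in> box l d" "gs \<in> parts_upto c" "vs \<noteq> []" "0 < d" for us vs gs hs c d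
    using that by (cases vs) (auto simp: box_def parts_upto_Cons)
  consider "last us = 0" "last vs = 0" | "last us \<noteq> 0" "last vs \<noteq> 0"
    | "last us = 0" "last vs \<noteq> 0" | "last us \<noteq> 0" "last vs = 0" by blast
  then have cd: "c = d \<and> strip l cs = strip l ds"
  proof cases
    case 1
    then have *: "c = d" "gs = hs" "butlast us = butlast vs" using eq s by auto
    with 1 ne have "us = vs" by (metis append_butlast_last_id)
    with * s show ?thesis by simp
  next
    case 2
    then have *: "c = d" "gs = hs" "map (\<lambda>w. w - 1) us = map (\<lambda>w. w - 1) vs" using eq s by auto
    have "map Suc (map (\<lambda>w. w - 1) us) = us" "map Suc (map (\<lambda>w. w - 1) vs) = vs"
      using box_last_pos[OF b(1) 2(1)] box_last_pos[OF b(3) 2(2)] by (auto intro!: map_idI)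
    then show ?thesis using * s by metis
  next
    case 3
    then show ?thesis using bb[of vs c us gs d hs] eq s b ne cs by auto
  next
    case 4
    then show ?thesis using bb[of us d vs hs c gs] eq s b ne cs by auto
  qed
  then have "cs = ds" using Cons.IH[of c ds] cs by blast
  with cd ds' show ?case by blast
qed

text \<open>The same distinction tells how to undo a step for an arbitrary pair: a first window entry
  not smaller than the latest recorded value is taken out of the window, otherwise the recorded
  value is put back and the window raised by one. The total size decreases each time.\<close>

lemma strip_surj:
  assumes "0 < l"
  shows "\<lbrakk>ws \<in> box l k; hs \<in> parts_upto k\<rbrakk> \<Longrightarrow> \<exists>cs \<in> parts_upto k. strip l cs = (ws, hs)"
proof (induction "sum_list ws + sum_list hs + l * length hs" arbitrary: ws hs k rule: less_induct)
  case less
  obtain w vs where ws: "ws = w # vs" using less.prems assms by (cases ws) (auto simp: box_def)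
  have vs: "length ws = l" "set vs \<subseteq> {..w}" "sorted_wrt (\<ge>) vs" "w \<le> k" using less.prems ws by (auto simp: box_def)
  consider "w = 0" "hs = []" | "0 < w" "hs \<in> parts_upto w" | h gs where "hs = h # gs" "w < h"
    using less.prems by (cases hs) (auto simp: parts_upto_Cons, metis linorder_not_less neq0_conv)
  then show ?case
  proof cases
    case 1
    then have "ws = replicate l 0" using vs ws by (auto intro!: replicate_eqI)
    with 1 show ?thesis by (intro bexI[of _ "[]"]) auto
  next
    case 2
    have "vs @ [0] \<in> box l w" using vs ws by (auto simp: box_def sorted_wrt_append)
    then obtain cs where "cs \<in> parts_upto w" "strip l cs = (vs @ [0], hs)"
      using less.hyps[of "vs @ [0]" hs w] 2 ws by auto
    then show ?thesis using 2 vs ws by (intro bexI[of _ "w # cs"]) (auto simp: parts_upto_Cons)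
  next
    case (3 h gs)
    have h: "gs \<in> parts_upto h" "0 < h" "h \<le> k" using less.prems 3 by (auto simp: parts_upto_Cons)
    have "map Suc ws \<in> box l h"
      using less.prems 3 vs ws by (fastforce simp: box_def sorted_wrt_map)
    then obtain cs where cs: "cs \<in> parts_upto h" "strip l cs = (map Suc ws, gs)"
      using less.hyps[of "map Suc ws" gs h] h 3 vs by (auto simp: sum_list_Suc[of "\<lambda>x. x", simplified])
    have "last (map Suc ws) \<noteq> 0" using ws by (simp add: last_map del: list.map)
    then show ?thesis using cs h 3 by (intro bexI[of _ "h # cs"]) (auto simp: parts_upto_Cons comp_def)
  qed
qed

lemma bij_betw_strip:
  assumes "0 < l" shows "bij_betw (strip l) (parts_upto k) (box l k \<times> parts_upto k)"
  unfolding bij_betw_def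
proof
  show "inj_on (strip l) (parts_upto k)"
    by (rule inj_onI) (rule strip_inj[OF assms])
  show "strip l ` parts_upto k = box l k \<times> parts_upto k"
  proof
    show "strip l ` parts_upto k \<subseteq> box l k \<times> parts_upto k"
      using strip_in[OF assms] by blast
    show "box l k \<times> parts_upto k \<subseteq> strip l ` parts_upto k"
    proof
      fix p assume "p \<in> box l k \<times> parts_upto k"
      then obtain cs where "cs \<in> parts_upto k" "strip l cs = p"
        using strip_surj[OF assms, of "fst p" k "snd p"] by auto
      then show "p \<in> strip l ` parts_upto k" by blast
    qed
  qed
qed

text \<open>With at most \<open>l\<close> columns the window never gets full, so no hook is removed.\<close>

lemma strip_short:
  "\<lbrakk>cs \<in> parts_upto k; length cs \<le> l\<rbrakk> \<Longrightarrow> strip l cs = (cs @ replicate (l - length cs) 0, [])"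
proof (induction cs arbitrary: k)
  case (Cons c cs)
  then have cs: "strip l cs = (cs @ replicate (l - length cs) 0, [])"
    by (auto simp: parts_upto_Cons)
  obtain n where n: "l - length cs = Suc n" "l - length (c # cs) = n"
    using Cons.prems by (cases "l - length cs") auto
  have "cs @ replicate (l - length cs) 0 = (cs @ replicate n 0) @ [0]"
    unfolding n(1) by (simp add: replicate_append_same)
  with cs n show ?case by (simp add: butlast_append)
qed simp

text \<open>The window after a step depends on the previous window but not on the recorded hooks.\<close>

lemma fst_strip_append:
  "fst (strip l ds) = fst (strip l es) \<Longrightarrow> fst (strip l (us @ ds)) = fst (strip l (us @ es))"
  by (induction us) (auto simp: Let_def split: prod.splits)

text \<open>In a weakly decreasing list the zeros are a padding at the end.\<close>

lemma filter_pos_sorted: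
  "sorted_wrt (\<ge>) (ws :: nat list) \<Longrightarrow>
    filter ((<) 0) ws @ replicate (length ws - length (filter ((<) 0) ws)) 0 = ws"
proof (induction ws)
  case (Cons w ws)
  show ?case
  proof (cases "w = 0")
    case True
    then have "w # ws = replicate (length (w # ws)) 0"
      using Cons.prems by (intro replicate_eqI) auto
    then show ?thesis by (metis True append_Nil diff_zero filter_replicate length_0_conv less_irrefl)
  next
    case False
    with Cons show ?thesis by (auto simp: Suc_diff_le)
  qed
qed simp

lemma parts_upto_appendD:
  assumes "us @ cs \<in> parts_upto k" shows "us \<in> parts_upto k" "cs \<in> parts_upto k"
  using assms by (auto simp: parts_upto_def sorted_wrt_append)

lemma parts_upto_box: "cs \<in> parts_upto k \<Longrightarrow> cs \<in> box (length cs) k"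
  by (auto simp: parts_upto_def box_def)

lemma filter_pos_box: "ws \<in> box l k \<Longrightarrow> filter ((<) 0) ws \<in> parts_upto k"
  by (auto simp: parts_upto_def box_def sorted_wrt_filter)

text \<open>When \<open>l\<close> positive columns \<open>ws\<close> follow the column \<open>c\<close>, the first hook removed by \<open>strip\<close> is
  the one starting at \<open>c\<close>. So \<open>strip\<close> and the iteration that removes one rim hook at a time
  have the same residue.\<close>

lemma strip_hook:
  assumes "us @ c # ws \<in> parts_upto k" "length ws = l" "0 < l"
  shows "fst (strip l (us @ c # ws)) = fst (strip l (us @ filter ((<) 0) (map (\<lambda>w. w - 1) ws)))"
proof (rule fst_strip_append)
  let ?vs = "map (\<lambda>w. w - 1) ws"
  have ws: "ws \<in> parts_upto c"
    using parts_upto_appendD(2)[OF assms(1)] by (auto simp: parts_upto_Cons)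
  have vs: "?vs \<in> box l (c - 1)" using box_dec[OF parts_upto_box[OF ws]] assms by simp
  have "last ws \<in> set ws" using assms by (intro last_in_set) auto
  then have "last ws \<noteq> 0" using ws by (auto simp: parts_upto_def)
  moreover have "strip l ws = (ws, [])" using strip_short[OF ws] assms by simp
  ultimately have "fst (strip l (c # ws)) = ?vs" by simp
  also have "?vs = fst (strip l (filter ((<) 0) ?vs))"
    using strip_short[OF filter_pos_box[OF vs], of l] filter_pos_sorted[of ?vs] vs assms
      length_filter_le[of "(<) 0" ?vs]
    by (simp add: box_def)
  finally show "fst (strip l (c # ws)) = fst (strip l (filter ((<) 0) ?vs))" .
qed

lemma num_columns_column_diagram:
  assumes "cs \<in> parts_upto k"
  shows "num_columns (column_diagram cs) = length cs"
proof -
  have "snd ` column_diagram cs = {1..length cs}"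
  proof (intro equalityI subsetI)
    fix j assume j: "j \<in> {1..length cs}"
    then have "cs ! (j - 1) \<in> set cs" by auto
    then have "1 \<le> cs ! (j - 1)" using assms by (auto simp: parts_upto_def)
    with j have "(1, j) \<in> column_diagram cs" by (auto simp: column_diagram_def)
    then show "j \<in> snd ` column_diagram cs" by force
  qed (auto simp: column_diagram_def)
  then show ?thesis by (simp add: num_columns_def)
qed

text \<open>In column \<open>j\<close> the rim consists of the cells not higher up than the bottom cell of
  column \<open>j + 1\<close>. Removing them leaves one cell less than column \<open>j + 1\<close> has. On the last
  \<open>l + 1\<close> columns the net effect is that the first of these columns is deleted and the others
  shrink by one, as in \<open>strip\<close>.\<close>

lemma strip_rim_hook_column_diagram:
  assumes "us @ c # ws \<in> parts_upto k" "length ws = l"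
  shows "strip_rim_hook l (column_diagram (us @ c # ws)) =
         column_diagram (us @ map (\<lambda>w. w - 1) ws)" (is "_ = ?T")
proof (rule cell_set_eqI)
  let ?cs = "us @ c # ws"
  fix i j
  have N: "num_columns (column_diagram ?cs) = length us + l + 1"
    using num_columns_column_diagram[OF assms(1)] assms(2) by simp
  have sorted: "?cs ! b \<le> ?cs ! a" if "a \<le> b" "b < length ?cs" for a b
  proof (cases "a = b")
    case False
    then show ?thesis
      using assms(1) that sorted_wrt_nth_less[of "(\<ge>)" ?cs a b] by (auto simp: parts_upto_def)
  qed simp
  have nxt: "?cs ! Suc j = ws ! (j - length us)" if "length us \<le> j"
    using that by (simp add: nth_append Suc_diff_le)
  have "(Suc i, Suc j) \<in> strip_rim_hook l (column_diagram ?cs) \<longleftrightarrow>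
      (Suc i, Suc j) \<in> column_diagram ?cs \<and>
      (j < length us \<or> (Suc (Suc i), Suc (Suc j)) \<in> column_diagram ?cs)"
    unfolding strip_rim_hook_def rim_def N by auto
  also have "\<dots> \<longleftrightarrow> (Suc i, Suc j) \<in> ?T"
  proof (cases "j < length us")
    case True
    then show ?thesis unfolding mem_column_diagram by (auto simp: nth_append)
  next
    case False
    have T: "(Suc i, Suc j) \<in> ?T \<longleftrightarrow> j < length us + l \<and> Suc i < ws ! (j - length us)"
      using False assms(2) unfolding mem_column_diagram by (auto simp: nth_append)
    show ?thesis
      unfolding T unfolding mem_column_diagram using False nxt sorted[of j "Suc j"] assms(2) by auto
  qed
  finally show "(Suc i, Suc j) \<in> strip_rim_hook l (column_diagram ?cs) \<longleftrightarrow> (Suc i, Suc j) \<in> ?T" .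
qed (auto simp: strip_rim_hook_def dest: column_diagram_pos)

lemma parts_upto_after_hook:
  assumes "us @ c # ws \<in> parts_upto k"
  shows "us @ filter ((<) 0) (map (\<lambda>w. w - 1) ws) \<in> parts_upto k"
proof -
  have ws: "ws \<in> parts_upto c" "c \<le> k" and us: "us \<in> parts_upto k" "\<forall>u\<in>set us. c \<le> u"
    using assms parts_upto_appendD[OF assms] by (auto simp: parts_upto_Cons parts_upto_def sorted_wrt_append)
  have "filter ((<) 0) (map (\<lambda>w. w - 1) ws) \<in> parts_upto (c - 1)"
    by (rule filter_pos_box[OF box_dec[OF parts_upto_box[OF ws(1)]]])
  with us ws(2) show ?thesis
    unfolding parts_upto_def by (fastforce simp: sorted_wrt_append)
qed

lemma column_diagram_append_zeros:
  "column_diagram (cs @ replicate t 0) = column_diagram cs"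
  by (rule cell_set_eqI)
     (auto simp: mem_column_diagram nth_append dest: column_diagram_pos)

text \<open>One pass of the loop does what \<open>strip_hook\<close> describes and removes at least one column, so
  induction on the number of columns applies.\<close>

lemma while_strip_rim_hook:
  assumes "0 < l" "cs \<in> parts_upto k"
  shows "while (\<lambda>S. l + 1 \<le> num_columns S) (strip_rim_hook l) (column_diagram cs) =
         column_diagram (fst (strip l cs))"
  using assms(2)
proof (induction "length cs" arbitrary: cs rule: less_induct)
  case less
  note cs = less.prems
  have N: "num_columns (column_diagram cs) = length cs"
    by (rule num_columns_column_diagram[OF cs])
  show ?case
  proof (cases "length cs \<le> l")
    case True
    then show ?thesis
      by (subst while_unfold) (simp add: N strip_short[OF cs] column_diagram_append_zeros)
  next
    case False
    define p where "p = length cs - l - 1"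
    define ws where "ws = drop (Suc p) cs"
    let ?vs = "map (\<lambda>w. w - 1) ws" let ?ds = "take p cs @ filter ((<) 0) ?vs"
    have split: "cs = take p cs @ cs ! p # ws" and len: "length ws = l"
      using False by (auto simp: p_def ws_def id_take_nth_drop)
    have ws: "ws \<in> parts_upto (cs ! p)" and us: "take p cs \<in> parts_upto k"
      using parts_upto_appendD[of "take p cs" "cs ! p # ws" k] cs split by (auto simp: parts_upto_Cons)
    have "?ds \<in> parts_upto k"
      using parts_upto_after_hook[of "take p cs" "cs ! p" ws k] cs split by simp
    moreover have "length ?ds < length cs"
      using len length_filter_le[of "(<) 0" ?vs] arg_cong[OF split, of length] by simp
    ultimately have IH: "while (\<lambda>S. l + 1 \<le> num_columns S) (strip_rim_hook l) (column_diagram ?ds) =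
        column_diagram (fst (strip l ?ds))"
      by (intro less.hyps)
    have vs: "?vs \<in> box l (cs ! p - 1)" using box_dec[OF parts_upto_box[OF ws]] len by simp
    have "strip_rim_hook l (column_diagram cs) = column_diagram (take p cs @ ?vs)"
      using strip_rim_hook_column_diagram[of "take p cs" "cs ! p" ws k l] split cs len by simp
    also have "take p cs @ ?vs = ?ds @ replicate (length ?vs - length (filter ((<) 0) ?vs)) 0"
      using filter_pos_sorted[of ?vs] vs by (simp add: box_def)
    also have "column_diagram \<dots> = column_diagram ?ds"
      by (rule column_diagram_append_zeros)
    finally have step: "strip_rim_hook l (column_diagram cs) = column_diagram ?ds" .
    have "fst (strip l cs) = fst (strip l ?ds)"
      using strip_hook[of "take p cs" "cs ! p" ws k l] split cs len assms(1) by simp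
    then show ?thesis using False IH by (subst while_unfold) (simp add: N step)
  qed
qed

text \<open>The link to the loop of the definition: its residual diagram is given by the final window.\<close>

lemma R1_eq:
  assumes "A1 xs \<in> parts_upto k"
  shows "R1 xs = column_diagram (fst (strip (n1 xs + 1) (conjugate (A1 xs))))"
  using while_strip_rim_hook[of "n1 xs + 1", OF _ conjugate_in_parts_upto[OF assms]]
  unfolding R1_def column_diagram_conjugate[OF assms] by simp

section \<open>Joining hook lengths with the parts below the rectangle\<close>

text \<open>A hook recorded as \<open>c\<close>, where \<open>1 \<le> c \<le> k\<close>, has length \<open>l + c\<close>. These lengths are the parts
  above \<open>l\<close>, and the parts up to \<open>l\<close> remain free for a second partition.\<close>

lemma bij_betw_merge:
  "bij_betw (\<lambda>(bs, hs). map ((+) l) hs @ bs) (parts_upto l \<times> parts_upto k) (parts_upto (l + k))"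
proof (rule bij_betw_byWitness[where f' =
      "\<lambda>cs. (filter (\<lambda>c. c \<le> l) cs, map (\<lambda>c. c - l) (filter (\<lambda>c. l < c) cs))"])
  have ff: "[x\<leftarrow>hs. l < l + x] = hs" "[x\<leftarrow>hs. l + x \<le> l] = []" 
      "[x\<leftarrow>bs. x \<le> l] = bs" "[x\<leftarrow>bs. l < x] = []" "[x\<leftarrow>hs. 0 < x] = hs" "[x\<leftarrow>hs. x = 0] = []"
      if "bs \<in> parts_upto l" "hs \<in> parts_upto k" for bs hs
    using that by (auto simp: parts_upto_def filter_id_conv filter_empty_conv)
  show "\<forall>a\<in>parts_upto l \<times> parts_upto k.
      (filter (\<lambda>c. c \<le> l) (case a of (bs, hs) \<Rightarrow> map ((+) l) hs @ bs),
       map (\<lambda>c. c - l) (filter (\<lambda>c. l < c) (case a of (bs, hs) \<Rightarrow> map ((+) l) hs @ bs))) = a"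
    by (auto simp: filter_map comp_def ff)
  have sp: "filter (\<lambda>c. l < c) cs @ filter (\<lambda>c. c \<le> l) cs = cs" if "sorted_wrt (\<ge>) cs" for cs :: "nat list"
    using that
  proof (induction cs)
    case (Cons c cs)
    show ?case
    proof (cases "l < c")
      case False
      with Cons.prems have "filter (\<lambda>c. l < c) (c # cs) = []" "filter (\<lambda>c. c \<le> l) (c # cs) = c # cs"
        by (auto simp: filter_empty_conv filter_id_conv)
      then show ?thesis by simp
    qed (use Cons in auto)
  qed simp
  have mm: "map ((+) l) (map (\<lambda>c. c - l) (filter (\<lambda>c. l < c) cs)) = filter (\<lambda>c. l < c) cs" for cs
    by (auto intro!: map_idI)
  show "\<forall>cs\<in>parts_upto (l + k).
      (case (filter (\<lambda>c. c \<le> l) cs, map (\<lambda>c. c - l) (filter (\<lambda>c. l < c) cs)) of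
        (bs, hs) \<Rightarrow> map ((+) l) hs @ bs) = cs"
    using mm sp by (auto simp: parts_upto_def simp del: map_map)
  show "(\<lambda>(bs, hs). map ((+) l) hs @ bs) ` (parts_upto l \<times> parts_upto k) \<subseteq> parts_upto (l + k)"
    by (force simp: parts_upto_def sorted_wrt_append sorted_wrt_map)
  show "(\<lambda>cs. (filter (\<lambda>c. c \<le> l) cs, map (\<lambda>c. c - l) (filter (\<lambda>c. l < c) cs))) ` parts_upto (l + k)
      \<subseteq> parts_upto l \<times> parts_upto k"
    by (force simp: parts_upto_def sorted_wrt_filter sorted_wrt_map
        intro: sorted_wrt_mono_rel[where P = "(\<ge>)"])
qed

section \<open>Frobenius symbols of partitions in a box\<close>

text \<open>Frobenius symbols of the partitions with at most \<open>b\<close> rows and \<open>a\<close> columns, as lists of pairs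
  \<open>(x\<^sub>i, y\<^sub>i)\<close>. Both coordinates are strictly decreasing.\<close>

definition frobenius_symbols :: "nat \<Rightarrow> nat \<Rightarrow> (nat \<times> nat) list set" where
  "frobenius_symbols a b =
     {fs. sorted_wrt (\<lambda>p q. fst q < fst p \<and> snd q < snd p) fs \<and> set fs \<subseteq> {..<a} \<times> {..<b}}"

lemma frobenius_symbols_Nil [simp]: "[] \<in> frobenius_symbols a b"
  by (simp add: frobenius_symbols_def)

lemma frobenius_symbols_Cons:
  "(x, y) # fs \<in> frobenius_symbols a b \<longleftrightarrow> x < a \<and> y < b \<and> fs \<in> frobenius_symbols x y"
  by (fastforce simp: frobenius_symbols_def)

text \<open>The symbol of a column list. The head is the principal hook: \<open>w - 1\<close> cells below the corner
  and one cell to its right for each further nonempty column. Without this hook, the remaining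
  columns are one cell shorter.\<close>

fun frobenius :: "nat list \<Rightarrow> (nat \<times> nat) list" where
  "frobenius [] = []"
| "frobenius (w # ws) =
     (if w = 0 then []
      else (length (filter ((<) 0) ws), w - 1) # frobenius (map (\<lambda>v. v - 1) (filter ((<) 0) ws)))"

text \<open>The inner column list has exactly \<open>x\<close> entries, one for each column to the right of the
  corner that the principal hook meets.\<close>

fun from_frobenius :: "nat \<Rightarrow> (nat \<times> nat) list \<Rightarrow> nat list" where
  "from_frobenius l [] = replicate l 0"
| "from_frobenius l ((x, y) # fs) =
     Suc y # map Suc (from_frobenius x fs) @ replicate (l - 1 - x) 0"

lemma box_Cons: "w # ws \<in> box l k \<longleftrightarrow> w \<le> k \<and> 0 < l \<and> ws \<in> box (l - 1) w"
  by (cases l) (auto simp: box_def)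

lemma box_inner:
  assumes "ws \<in> box l k"
  shows "map (\<lambda>v. v - 1) (filter ((<) 0) ws) \<in> box (length (filter ((<) 0) ws)) (k - 1)"
  by (rule box_dec[OF parts_upto_box[OF filter_pos_box[OF assms]]])

lemma frobenius_in:
  "ws \<in> box l k \<Longrightarrow> frobenius ws \<in> frobenius_symbols l k"
proof (induction ws arbitrary: l k rule: frobenius.induct)
  case (2 w ws)
  let ?x = "length (filter ((<) 0) ws)"
  have ws: "w \<le> k" "0 < l" "ws \<in> box (l - 1) w" using 2 by (auto simp: box_Cons)
  have "?x < l" by (rule le_less_trans[OF length_filter_le]) (use ws in \<open>auto simp: box_def\<close>)
  then show ?case using 2(1)[OF _ box_inner[OF ws(3)]] ws by (auto simp: frobenius_symbols_Cons)
qed simp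

lemma sum_list_inner:
  "sum_list (map (\<lambda>v. v - 1) (filter ((<) 0) ws)) + length (filter ((<) 0) ws) = sum_list (ws :: nat list)"
  by (induction ws) auto

abbreviation frobenius_size :: "(nat \<times> nat) list \<Rightarrow> nat" where
  "frobenius_size fs \<equiv> sum_list (map (\<lambda>(x, y). x + y + 1) fs)"

lemma frobenius_size: "ws \<in> box l k \<Longrightarrow> frobenius_size (frobenius ws) = sum_list ws"
proof (induction ws arbitrary: l k rule: frobenius.induct)
  case (2 w ws)
  have ws: "ws \<in> box (l - 1) w" using 2 by (auto simp: box_Cons)
  show ?case
  proof (cases "w = 0")
    case True then show ?thesis using ws by (auto simp: box_def)
  next
    case False
    then show ?thesis using 2(1)[OF _ box_inner[OF ws]] sum_list_inner[of ws] by simp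
  qed
qed simp

lemma from_frobenius_in:
  "fs \<in> frobenius_symbols l k \<Longrightarrow> from_frobenius l fs \<in> box l k"
proof (induction l fs arbitrary: k rule: from_frobenius.induct)
  case (1 l)
  then show ?case by (auto simp: box_def sorted_wrt_replicate)
next
  case (2 l x y fs)
  then have "x < l" "y < k" and IH: "from_frobenius x fs \<in> box x y"
    by (auto simp: frobenius_symbols_Cons)
  then show ?case
    by (auto simp: box_def sorted_wrt_append sorted_wrt_map sorted_wrt_replicate)
qed

lemma frobenius_from_frobenius:
  "fs \<in> frobenius_symbols l k \<Longrightarrow> frobenius (from_frobenius l fs) = fs"
proof (induction l fs arbitrary: k rule: from_frobenius.induct)
  case (1 l)
  then show ?case by (cases l) auto
next
  case (2 l x y fs)
  then have mem: "fs \<in> frobenius_symbols x y" by (auto simp: frobenius_symbols_Cons)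
  have "length (from_frobenius x fs) = x" using from_frobenius_in[OF mem] by (simp add: box_def)
  with 2(1)[OF mem] show ?case by (simp add: comp_def)
qed

lemma from_frobenius_frobenius:
  "ws \<in> box l k \<Longrightarrow> from_frobenius l (frobenius ws) = ws"
proof (induction ws arbitrary: l k rule: frobenius.induct)
  case 1 then show ?case by (simp add: box_def)
next
  case (2 w ws)
  have ws: "ws \<in> box (l - 1) w" using 2 by (auto simp: box_Cons)
  show ?case
  proof (cases "w = 0")
    case True
    with 2 show ?thesis by (auto simp: box_def intro!: replicate_eqI[symmetric])
  next
    case False
    have "map Suc (map (\<lambda>v. v - 1) (filter ((<) 0) ws)) = filter ((<) 0) ws"
      by (auto intro!: map_idI)
    moreover have "length ws = l - 1" "sorted_wrt (\<ge>) ws" using ws by (auto simp: box_def)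
    ultimately show ?thesis
      using False 2(1)[OF False box_inner[OF ws]] filter_pos_sorted[of ws] by simp
  qed
qed

lemma bij_betw_frobenius: "bij_betw frobenius (box l k) (frobenius_symbols l k)"
  by (rule bij_betw_byWitness[where f' = "from_frobenius l"])
     (auto intro: from_frobenius_frobenius frobenius_from_frobenius from_frobenius_in frobenius_in)

section \<open>Frobenius coordinates of a column diagram\<close>

text \<open>Removing the principal hook and moving the rest one step towards the corner is what the
  recursion of \<open>frobenius\<close> does. The following lemmas use this to identify the coordinates
  defined by counting cells with the entries of the list.\<close>

lemma mem_column_diagram_inner:
  assumes "w # ws \<in> box l k"
  shows "(Suc (Suc i), Suc (Suc j)) \<in> column_diagram (w # ws) \<longleftrightarrow>
         (Suc i, Suc j) \<in> column_diagram (map (\<lambda>v. v - 1) (filter ((<) 0) ws))"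
proof -
  let ?us = "filter ((<) 0) ws"
  have "sorted_wrt (\<ge>) ws" using assms by (auto simp: box_def)
  then have ws: "ws = ?us @ replicate (length ws - length ?us) 0" (is "_ = _ @ ?z")
    by (rule filter_pos_sorted[symmetric])
  have "j < length ws \<and> Suc i < ws ! j \<longleftrightarrow> j < length ?us \<and> Suc i < ?us ! j"
  proof (cases "j < length ?us")
    case True
    then have "j < length ws" by (rule less_le_trans[OF _ length_filter_le])
    moreover have "ws ! j = ?us ! j" by (subst ws) (simp add: nth_append True)
    ultimately show ?thesis using True by simp
  next
    case False
    then have "ws ! j = 0" if "j < length ws" using that by (subst ws) (simp add: nth_append)
    then show ?thesis using False by auto
  qed
  then show ?thesis unfolding mem_column_diagram by auto
qed

lemma frob_x_column_diagram:
  "\<lbrakk>ws \<in> box l k; i < length (frobenius ws)\<rbrakk> \<Longrightarrow>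
     frob_x (column_diagram ws) (Suc i) = fst (frobenius ws ! i)"
proof (induction ws arbitrary: l k i rule: frobenius.induct)
  case (2 w ws)
  let ?us = "filter ((<) 0) ws" let ?inner = "map (\<lambda>v. v - 1) ?us"
  have w: "w \<noteq> 0" using 2(3) by (auto split: if_splits)
  have ws: "ws \<in> box (l - 1) w" using 2(2) by (auto simp: box_Cons)
  show ?case
  proof (cases i)
    case 0
    have sorted: "sorted_wrt (\<ge>) ws" using ws by (auto simp: box_def)
    have pos: "0 < ws ! j \<longleftrightarrow> j < length ?us" if "j < length ws" for j
    proof -
      have "ws ! j = (?us @ replicate (length ws - length ?us) 0) ! j"
        by (simp only: filter_pos_sorted[OF sorted])
      moreover have "j < length ?us \<Longrightarrow> 0 < ?us ! j" using nth_mem[of j ?us] by auto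
      ultimately show ?thesis using that by (auto simp: nth_append)
    qed
    have "{c \<in> column_diagram (w # ws). fst c = Suc 0 \<and> Suc 0 < snd c} =
        (\<lambda>j. (Suc 0, Suc (Suc j))) ` {..<length ?us}"
    proof (intro equalityI subsetI)
      fix c assume c: "c \<in> {c \<in> column_diagram (w # ws). fst c = Suc 0 \<and> Suc 0 < snd c}"
      then obtain j where j: "c = (Suc 0, Suc (Suc j))"
        by (cases c) (auto simp: less_iff_Suc_add)
      with c pos show "c \<in> (\<lambda>j. (Suc 0, Suc (Suc j))) ` {..<length ?us}"
        by (auto simp: mem_column_diagram)
    next
      fix c assume "c \<in> (\<lambda>j. (Suc 0, Suc (Suc j))) ` {..<length ?us}"
      then obtain j where j: "c = (Suc 0, Suc (Suc j))" "j < length ?us" by auto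
      from j(2) have "j < length ws" by (rule less_le_trans[OF _ length_filter_le])
      with j pos show "c \<in> {c \<in> column_diagram (w # ws). fst c = Suc 0 \<and> Suc 0 < snd c}"
        by (auto simp: mem_column_diagram)
    qed
    then show ?thesis using 0 w by (simp add: frob_x_def card_image inj_on_def)
  next
    case (Suc i')
    have "{c \<in> column_diagram (w # ws). fst c = Suc (Suc i') \<and> Suc (Suc i') < snd c} =
       map_prod Suc Suc ` {c \<in> column_diagram ?inner. fst c = Suc i' \<and> Suc i' < snd c}"
    proof (intro equalityI subsetI)
      fix c assume c: "c \<in> {c \<in> column_diagram (w # ws). fst c = Suc (Suc i') \<and> Suc (Suc i') < snd c}"
      then obtain j where j: "c = (Suc (Suc i'), Suc (Suc j))"
        by (cases c) (auto simp: less_iff_Suc_add)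
      with c have "(Suc i', Suc j) \<in> {c \<in> column_diagram ?inner. fst c = Suc i' \<and> Suc i' < snd c}"
        using mem_column_diagram_inner[OF 2(2)] by auto
      then show "c \<in> map_prod Suc Suc ` {c \<in> column_diagram ?inner. fst c = Suc i' \<and> Suc i' < snd c}"
        by (rule rev_image_eqI) (simp add: j)
    next
      fix c assume "c \<in> map_prod Suc Suc ` {c \<in> column_diagram ?inner. fst c = Suc i' \<and> Suc i' < snd c}"
      then obtain j where "c = (Suc (Suc i'), Suc j)" "(Suc i', j) \<in> column_diagram ?inner" "Suc i' < j"
        by auto
      moreover from this obtain j' where "j = Suc j'" by (cases j) auto
      ultimately show "c \<in> {c \<in> column_diagram (w # ws). fst c = Suc (Suc i') \<and> Suc (Suc i') < snd c}"
        using mem_column_diagram_inner[OF 2(2)] by auto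
    qed
    then have "frob_x (column_diagram (w # ws)) (Suc i) = frob_x (column_diagram ?inner) (Suc i')"
      unfolding frob_x_def Suc by (simp add: card_image inj_on_def)
    then show ?thesis using 2(1)[OF w box_inner[OF ws], of i'] 2(3) Suc w by simp
  qed
qed simp

lemma frob_y_column_diagram:
  "\<lbrakk>ws \<in> box l k; i < length (frobenius ws)\<rbrakk> \<Longrightarrow>
     frob_y (column_diagram ws) (Suc i) = snd (frobenius ws ! i)"
proof (induction ws arbitrary: l k i rule: frobenius.induct)
  case (2 w ws)
  let ?us = "filter ((<) 0) ws" let ?inner = "map (\<lambda>v. v - 1) ?us"
  have w: "w \<noteq> 0" using 2(3) by (auto split: if_splits)
  have ws: "ws \<in> box (l - 1) w" using 2(2) by (auto simp: box_Cons)
  show ?case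
  proof (cases i)
    case 0
    have "{c \<in> column_diagram (w # ws). snd c = Suc 0 \<and> Suc 0 < fst c} =
        (\<lambda>j. (Suc (Suc j), Suc 0)) ` {..<w - 1}"
    proof (intro equalityI subsetI)
      fix c assume c: "c \<in> {c \<in> column_diagram (w # ws). snd c = Suc 0 \<and> Suc 0 < fst c}"
      then obtain j where j: "c = (Suc (Suc j), Suc 0)"
        by (cases c) (auto simp: less_iff_Suc_add)
      with c show "c \<in> (\<lambda>j. (Suc (Suc j), Suc 0)) ` {..<w - 1}"
        by (auto simp: mem_column_diagram)
    qed (auto simp: mem_column_diagram)
    then show ?thesis using 0 w by (simp add: frob_y_def card_image inj_on_def)
  next
    case (Suc i')
    have "{c \<in> column_diagram (w # ws). snd c = Suc (Suc i') \<and> Suc (Suc i') < fst c} =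
       map_prod Suc Suc ` {c \<in> column_diagram ?inner. snd c = Suc i' \<and> Suc i' < fst c}"
    proof (intro equalityI subsetI)
      fix c assume c: "c \<in> {c \<in> column_diagram (w # ws). snd c = Suc (Suc i') \<and> Suc (Suc i') < fst c}"
      then obtain j where j: "c = (Suc (Suc j), Suc (Suc i'))"
        by (cases c) (auto simp: less_iff_Suc_add)
      with c have "(Suc j, Suc i') \<in> {c \<in> column_diagram ?inner. snd c = Suc i' \<and> Suc i' < fst c}"
        using mem_column_diagram_inner[OF 2(2)] by auto
      then show "c \<in> map_prod Suc Suc ` {c \<in> column_diagram ?inner. snd c = Suc i' \<and> Suc i' < fst c}"
        by (rule rev_image_eqI) (simp add: j)
    next
      fix c assume "c \<in> map_prod Suc Suc ` {c \<in> column_diagram ?inner. snd c = Suc i' \<and> Suc i' < fst c}"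
      then obtain j where "c = (Suc j, Suc (Suc i'))" "(j, Suc i') \<in> column_diagram ?inner" "Suc i' < j"
        by auto
      moreover from this obtain j' where "j = Suc j'" by (cases j) auto
      ultimately show "c \<in> {c \<in> column_diagram (w # ws). snd c = Suc (Suc i') \<and> Suc (Suc i') < fst c}"
        using mem_column_diagram_inner[OF 2(2)] by auto
    qed
    then have "frob_y (column_diagram (w # ws)) (Suc i) = frob_y (column_diagram ?inner) (Suc i')"
      unfolding frob_y_def Suc by (simp add: card_image inj_on_def)
    then show ?thesis using 2(1)[OF w box_inner[OF ws], of i'] 2(3) Suc w by simp
  qed
qed simp

lemma frob_d_column_diagram:
  "ws \<in> box l k \<Longrightarrow> frob_d (column_diagram ws) = length (frobenius ws)"
proof (induction ws arbitrary: l k rule: frobenius.induct)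
  case 1
  have "column_diagram [] = {}" by (auto simp: column_diagram_def)
  then show ?case by (simp add: frob_d_def)
next
  case (2 w ws)
  let ?inner = "map (\<lambda>v. v - 1) (filter ((<) 0) ws)"
  let ?D = "\<lambda>ws. {c \<in> column_diagram ws. fst c = snd c}"
  have ws: "ws \<in> box (l - 1) w" using 2(2) by (auto simp: box_Cons)
  have fin: "finite (?D us)" for us
    by (rule finite_subset[of _ "(\<lambda>j. (j, j)) ` {..length us}"]) (auto simp: column_diagram_def)
  show ?case
  proof (cases "w = 0")
    case True
    then have "set (w # ws) \<subseteq> {0}" using ws by (auto simp: box_def)
    then have "(w # ws) ! j = 0" if "j < length (w # ws)" for j
      using that nth_mem[of j "w # ws"] by blast
    then have "?D (w # ws) = {}" by (fastforce simp: column_diagram_def)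
    then have "frob_d (column_diagram (w # ws)) = 0" unfolding frob_d_def by (simp only: card.empty)
    with True show ?thesis by simp
  next
    case False
    have "?D (w # ws) = insert (1, 1) (map_prod Suc Suc ` ?D ?inner)"
    proof (intro equalityI subsetI)
      fix c assume c: "c \<in> ?D (w # ws)"
      then obtain i where i: "c = (Suc i, Suc i)"
        using column_diagram_pos[of c "w # ws"] by (cases c; cases "fst c") auto
      show "c \<in> insert (1, 1) (map_prod Suc Suc ` ?D ?inner)"
      proof (cases i)
        case (Suc i')
        with c i have "(i, i) \<in> ?D ?inner" using mem_column_diagram_inner[OF 2(2)] by auto
        then have "c \<in> map_prod Suc Suc ` ?D ?inner" by (rule rev_image_eqI) (simp add: i)
        then show ?thesis by simp
      qed (simp add: i)
    next
      fix c assume c: "c \<in> insert (1, 1) (map_prod Suc Suc ` ?D ?inner)"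
      show "c \<in> ?D (w # ws)"
      proof (cases "c = (1, 1)")
        case True
        then show ?thesis using False mem_column_diagram[of 0 0 "w # ws"] by simp
      next
        case 1: False
        with c obtain i where i: "c = (Suc i, Suc i)" "(i, i) \<in> column_diagram ?inner" by auto
        then obtain i' where "i = Suc i'" using column_diagram_pos[OF i(2)] by (cases i) auto
        then show ?thesis using i mem_column_diagram_inner[OF 2(2)] by auto
      qed
    qed
    moreover have "(1, 1) \<notin> map_prod Suc Suc ` ?D ?inner"
    proof
      assume "(1, 1) \<in> map_prod Suc Suc ` ?D ?inner"
      then have "(0, 0) \<in> column_diagram ?inner" by auto
      then show False using column_diagram_pos[of "(0, 0)" ?inner] by simp
    qed
    ultimately have "frob_d (column_diagram (w # ws)) = Suc (frob_d (column_diagram ?inner))"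
      unfolding frob_d_def using fin[of ?inner] by (simp add: card_image inj_on_def)
    then show ?thesis using 2(1)[OF False box_inner[OF ws]] False by simp
  qed
qed

section \<open>Reflecting a Frobenius symbol\<close>

text \<open>With \<open>y\<^sub>0 = b\<close> and \<open>x\<^sub>d\<^sub>+\<^sub>1 = -1\<close>, this says that \<open>y\<^sub>i - x\<^sub>i\<^sub>+\<^sub>1 > r\<close> for some \<open>i\<close>. In the
  recursion the leg \<open>y\<close> of each removed pair takes over the role of \<open>b\<close>.\<close>

fun reaches :: "nat \<Rightarrow> nat \<Rightarrow> (nat \<times> nat) list \<Rightarrow> bool" where
  "reaches r b [] \<longleftrightarrow> r \<le> b"
| "reaches r b ((x, y) # fs) \<longleftrightarrow> x + r < b \<or> reaches r y fs"

text \<open>The reflection principle for lattice paths in terms of Frobenius symbols. Let \<open>i\<close> be the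
  first index with \<open>y\<^sub>i - x\<^sub>i\<^sub>+\<^sub>1 > r\<close>. Up to \<open>i\<close> the arms grow by \<open>r\<close> and the legs shrink by \<open>r\<close>;
  after \<open>i\<close> arms and legs are exchanged.\<close>

fun reflect :: "nat \<Rightarrow> nat \<Rightarrow> (nat \<times> nat) list \<Rightarrow> (nat \<times> nat) list" where
  "reflect r b [] = []"
| "reflect r b ((x, y) # fs) =
     (if x + r < b then map prod.swap ((x, y) # fs) else (x + r, y - r) # reflect r y fs)"

text \<open>In the image of \<open>reflect\<close>, the place where the exchange happened is the first one
  at which the arm is smaller than the original leg of the preceding pair. The parameter \<open>b\<close>
  carries that leg, so it is updated to the restored value \<open>y + r\<close>.\<close>

fun unreflect :: "nat \<Rightarrow> nat \<Rightarrow> (nat \<times> nat) list \<Rightarrow> (nat \<times> nat) list" where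
  "unreflect r b [] = []"
| "unreflect r b ((x, y) # fs) =
     (if x < b then map prod.swap ((x, y) # fs) else (x - r, y + r) # unreflect r (y + r) fs)"

text \<open>The legs decrease from \<open>b\<close> on, and the condition needs one of them to be at least \<open>r\<close>.\<close>

lemma reaches_le: "\<lbrakk>fs \<in> frobenius_symbols a b; reaches r b fs\<rbrakk> \<Longrightarrow> r \<le> b"
proof (induction r b fs arbitrary: a rule: reaches.induct)
  case (2 r b x y fs)
  then show ?case using 2(1)[of x] by (auto simp: frobenius_symbols_Cons)
qed simp

lemma frobenius_symbols_swap:
  "map prod.swap fs \<in> frobenius_symbols b a \<longleftrightarrow> fs \<in> frobenius_symbols a b"
  by (induction fs arbitrary: a b) (auto simp: frobenius_symbols_Cons)

lemma frobenius_size_swap: "frobenius_size (map prod.swap fs) = frobenius_size fs"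
  by (induction fs) auto

text \<open>Before the exchange \<open>x + r \<ge> b > y\<close>, so the assumption \<open>b \<le> a + r\<close> is inherited by the
  inner symbol, and no leg drops below \<open>0\<close> by \<open>reaches_le\<close>. At the exchange, arms and legs of the
  inner part are below \<open>b - r\<close> and \<open>b\<close>, which fit into the new box in exchanged order.\<close>

lemma reflect_correct:
  assumes "fs \<in> frobenius_symbols a b" "reaches r b fs" "b \<le> a + r"
  shows "reflect r b fs \<in> frobenius_symbols (a + r) (b - r) \<and>
         frobenius_size (reflect r b fs) = frobenius_size fs \<and>
         unreflect r b (reflect r b fs) = fs"
  using assms
proof (induction r b fs arbitrary: a rule: reflect.induct)
  case (2 r b x y fs)
  have xy: "x < a" "y < b" and fs: "fs \<in> frobenius_symbols x y"
    using 2(2) by (auto simp: frobenius_symbols_Cons)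
  show ?case
  proof (cases "x + r < b")
    case True
    then show ?thesis
      using xy fs 2(4) frobenius_size_swap[of fs]
      by (auto simp: frobenius_symbols_Cons frobenius_symbols_swap)
  next
    case False
    then have "reaches r y fs" using 2(3) by simp
    moreover from this have "r \<le> y" by (rule reaches_le[OF fs])
    ultimately show ?thesis
      using 2(1)[OF False fs] False xy by (auto simp: frobenius_symbols_Cons)
  qed
qed simp

lemma unreflect_correct:
  assumes "fs \<in> frobenius_symbols (a + r) (b - r)" "r \<le> b" "b \<le> a + r"
  shows "unreflect r b fs \<in> frobenius_symbols a b \<and> reaches r b (unreflect r b fs) \<and>
         reflect r b (unreflect r b fs) = fs"
  using assms
proof (induction r b fs arbitrary: a rule: unreflect.induct)
  case (2 r b x y fs)
  have xy: "x < a + r" "y < b - r" and fs: "fs \<in> frobenius_symbols x y"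
    using 2(2) by (auto simp: frobenius_symbols_Cons)
  show ?case
  proof (cases "x < b")
    case True
    then show ?thesis
      using xy fs 2(4) by (auto simp: frobenius_symbols_Cons frobenius_symbols_swap)
  next
    case False
    then show ?thesis
      using 2(1)[OF False, of "x - r"] fs 2(3) xy by (auto simp: frobenius_symbols_Cons)
  qed
qed auto

lemma reaches_iff:
  "reaches r b fs \<longleftrightarrow> (\<exists>i\<le>length fs.
     int r + 1 + (if i = length fs then - 1 else int (fst (fs ! i)))
       \<le> (if i = 0 then int b else int (snd (fs ! (i - 1)))))"
proof (induction r b fs rule: reaches.induct)
  case (2 r b x y fs)
  let ?P = "\<lambda>b fs i. int r + 1 + (if i = length fs then - 1 else int (fst (fs ! i)))
       \<le> (if i = 0 then int b else int (snd (fs ! (i - 1))))"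
  have "?P b ((x, y) # fs) (Suc i) \<longleftrightarrow> ?P y fs i" for i by (cases i) auto
  moreover have "?P b ((x, y) # fs) 0 \<longleftrightarrow> x + r < b" by auto
  moreover have "(\<exists>i\<le>Suc n. Q i) \<longleftrightarrow> Q 0 \<or> (\<exists>i\<le>n. Q (Suc i))" for Q n
    by (metis Suc_le_mono le0 not0_implies_Suc)
  ultimately have "(\<exists>i\<le>length ((x, y) # fs). ?P b ((x, y) # fs) i) \<longleftrightarrow>
      x + r < b \<or> (\<exists>i\<le>length fs. ?P y fs i)"
    by (simp del: nth_Cons_Suc)
  then show ?case using 2 by simp
qed auto

section \<open>Rerank as a condition on the Frobenius symbol\<close>

lemma le_rerank_iff:
  assumes "R1 xs = column_diagram ws" "ws \<in> box l k"
  shows "int r \<le> rerank xs \<longleftrightarrow> reaches r (n1 xs) (frobenius ws)"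
proof -
  let ?fs = "frobenius ws"
  let ?x = "\<lambda>i. if i = length ?fs + 1 then - 1 else int (frob_x (R1 xs) i)"
  let ?y = "\<lambda>i. if i = 0 then int (n1 xs) else int (frob_y (R1 xs) i)"
  have Max_ge: "c \<le> (MAX i\<in>{0..n}. f i) \<longleftrightarrow> (\<exists>i\<le>n. c \<le> f i)" for c n and f :: "nat \<Rightarrow> int"
    by (subst Max_ge_iff) auto
  have d: "frob_d (R1 xs) = length ?fs"
    unfolding assms(1) by (rule frob_d_column_diagram[OF assms(2)])
  have "rerank xs = (MAX i\<in>{0..length ?fs}. ?y i - ?x (i + 1)) - 1"
    unfolding rerank_def Let_def d by (rule refl)
  then have "int r \<le> rerank xs \<longleftrightarrow> int r + 1 \<le> (MAX i\<in>{0..length ?fs}. ?y i - ?x (i + 1))"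
    by (simp only: le_diff_eq)
  also have "\<dots> \<longleftrightarrow> (\<exists>i\<le>length ?fs. int r + 1 \<le> ?y i - ?x (i + 1))"
    by (rule Max_ge)
  also have "\<dots> \<longleftrightarrow> reaches r (n1 xs) ?fs"
    unfolding reaches_iff
  proof (intro ex_cong1 conj_cong refl)
    fix i assume i: "i \<le> length ?fs"
    have "?x (i + 1) = (if i = length ?fs then - 1 else int (fst (?fs ! i)))"
      using frob_x_column_diagram[OF assms(2), of i] i by (auto simp: assms(1))
    moreover have "?y i = (if i = 0 then int (n1 xs) else int (snd (?fs ! (i - 1))))"
      using frob_y_column_diagram[OF assms(2), of "i - 1"] i by (auto simp: assms(1))
    ultimately show "int r + 1 \<le> ?y i - ?x (i + 1) \<longleftrightarrow>
        int r + 1 + (if i = length ?fs then - 1 else int (fst (?fs ! i)))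
          \<le> (if i = 0 then int (n1 xs) else int (snd (?fs ! (i - 1))))"
      by (simp only: le_diff_eq)
  qed
  finally show ?thesis .
qed

section \<open>Cutting a partition along its Durfee rectangle\<close>

text \<open>The bijections below are on partitions of all sizes at once; the size is tracked separately.\<close>

definition all_partitions :: "nat list set" where
  "all_partitions = {xs. sorted_wrt (\<ge>) xs \<and> (\<forall>x\<in>set xs. 0 < x)}"

lemma partitions_eq: "partitions n = {xs \<in> all_partitions. sum_list xs = n}"
  by (auto simp: partitions_def all_partitions_def)

text \<open>The rectangle used by rerank is the case \<open>d = 1\<close>; the reflected codes need
  \<open>d = 2 * r + 1\<close>.\<close>

definition durfee :: "nat \<Rightarrow> nat list \<Rightarrow> nat" where
  "durfee d xs = Max {m. {1..m} \<times> {1..m + d} \<subseteq> diagram xs}"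

lemma n1_eq_durfee: "n1 xs = durfee 1 xs"
  by (simp add: n1_def durfee_def)

text \<open>Since \<open>m + d\<close> is positive for \<open>m > 0\<close>, each row of the rectangle contains a cell, and its
  rightmost cell decides whether the row fits.\<close>

lemma rectangle_subset_diagram_iff:
  "{1..m} \<times> {1..m + d} \<subseteq> diagram xs \<longleftrightarrow> (\<forall>i<m. i < length xs \<and> m + d \<le> xs ! i)"
proof
  assume *: "{1..m} \<times> {1..m + d} \<subseteq> diagram xs"
  show "\<forall>i<m. i < length xs \<and> m + d \<le> xs ! i"
  proof (intro allI impI)
    fix i assume "i < m"
    then have "(Suc i, Suc (m + d - 1)) \<in> {1..m} \<times> {1..m + d}" by auto
    with * have "(Suc i, Suc (m + d - 1)) \<in> diagram xs" by blast
    with \<open>i < m\<close> show "i < length xs \<and> m + d \<le> xs ! i" unfolding mem_diagram by auto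
  qed
next
  assume *: "\<forall>i<m. i < length xs \<and> m + d \<le> xs ! i"
  show "{1..m} \<times> {1..m + d} \<subseteq> diagram xs"
  proof
    fix p assume "p \<in> {1..m} \<times> {1..m + d}"
    then have "p = (Suc (fst p - 1), Suc (snd p - 1))" "fst p - 1 < m" "snd p - 1 < m + d"
      by auto
    then obtain i j where "p = (Suc i, Suc j)" "i < m" "j < m + d" by blast
    with * show "p \<in> diagram xs" by (fastforce simp: mem_diagram)
  qed
qed

lemma le_length_if_rectangle:
  assumes "\<forall>i<m. i < length xs \<and> m + d \<le> xs ! i" shows "m \<le> length xs"
proof (rule leI, rule notI)
  assume "length xs < m"
  from assms[rule_format, OF this] show False by simp
qed

lemma finite_rectangle_sides: "finite {m. \<forall>i<m. i < length xs \<and> m + d \<le> xs ! i}"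
  by (rule finite_subset[OF _ finite_atMost[of "length xs"]])
     (unfold atMost_iff subset_iff mem_Collect_eq, intro allI impI, rule le_length_if_rectangle)

lemma durfee_eqI:
  assumes "k \<le> length xs" "\<And>x. x \<in> set (take k xs) \<Longrightarrow> k + d \<le> x"
    and "\<And>x. x \<in> set (drop k xs) \<Longrightarrow> x \<le> k + d"
  shows "durfee d xs = k"
  unfolding durfee_def rectangle_subset_diagram_iff
proof (rule Max_eqI)
  show "finite {m. \<forall>i<m. i < length xs \<and> m + d \<le> xs ! i}"
    by (rule finite_rectangle_sides)
  have "k + d \<le> xs ! i" if "i < k" for i
  proof -
    have "take k xs ! i \<in> set (take k xs)" using that assms(1) by (intro nth_mem) simp
    then show ?thesis using assms(2) that by simp
  qed
  then show "k \<in> {m. \<forall>i<m. i < length xs \<and> m + d \<le> xs ! i}"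
    using assms(1) by auto
  fix m assume m: "m \<in> {m. \<forall>i<m. i < length xs \<and> m + d \<le> xs ! i}"
  show "m \<le> k"
  proof (rule ccontr)
    assume "\<not> m \<le> k"
    with m have k: "k < length xs" "m + d \<le> xs ! k" by auto
    then have "xs ! k \<in> set (drop k xs)" by (metis Cons_nth_drop_Suc list.set_intros(1))
    with assms(3) k \<open>\<not> m \<le> k\<close> show False by force
  qed
qed

text \<open>If some part below the rectangle were longer than \<open>k + d\<close>, then so would be the part in row
  \<open>k + 1\<close> and all parts above, and the rectangle of height \<open>k + 1\<close> would fit as well.\<close>

lemma durfee_maximal:
  assumes "sorted_wrt (\<ge>) xs"
  shows "durfee d xs \<le> length xs"
    and "x \<in> set (take (durfee d xs) xs) \<Longrightarrow> durfee d xs + d \<le> x"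
    and "x \<in> set (drop (durfee d xs) xs) \<Longrightarrow> x \<le> durfee d xs + d"
proof -
  let ?M = "{m. \<forall>i<m. i < length xs \<and> m + d \<le> xs ! i}" and ?k = "durfee d xs"
  have fin: "finite ?M"
    by (rule finite_rectangle_sides)
  have eq: "?k = Max ?M" unfolding durfee_def rectangle_subset_diagram_iff ..
  have "0 \<in> ?M" by simp
  then have mem: "?k \<in> ?M" unfolding eq using Max_in[OF fin] by blast
  then show le: "?k \<le> length xs" by (intro le_length_if_rectangle) (rule CollectD)
  have sorted: "xs ! b \<le> xs ! a" if "a \<le> b" "b < length xs" for a b
    using sorted_wrt_nth_less[OF assms, of a b] that by (cases "a = b") auto
  show "?k + d \<le> x" if "x \<in> set (take ?k xs)"
    using that mem by (auto simp: in_set_conv_nth)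
  show "x \<le> ?k + d" if "x \<in> set (drop ?k xs)"
  proof (rule ccontr)
    assume "\<not> x \<le> ?k + d"
    from that obtain i where "i < length xs - ?k" "x = xs ! (?k + i)"
      by (auto simp: in_set_conv_nth)
    then have k: "?k < length xs" "x \<le> xs ! ?k" using sorted[of ?k "?k + i"] by auto
    \<comment> \<open>The next larger rectangle would fit.\<close>
    have "Suc ?k \<in> ?M"
    proof (intro CollectI allI impI)
      fix i assume "i < Suc ?k"
      then show "i < length xs \<and> Suc ?k + d \<le> xs ! i"
        using sorted[of i ?k] k \<open>\<not> x \<le> ?k + d\<close> by auto
    qed
    then have "Suc ?k \<le> ?k" unfolding eq by (rule Max_ge[OF fin])
    then show False by simp
  qed
qed

definition rows_beside :: "nat \<Rightarrow> nat \<Rightarrow> nat list \<Rightarrow> nat list" where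
  "rows_beside d k xs = filter ((<) 0) (map (\<lambda>x. x - (k + d)) (take k xs))"

lemma A1_eq_rows_beside: "A1 xs = rows_beside 1 (n1 xs) xs"
  by (simp add: A1_def rows_beside_def)

text \<open>The partition to the right of the rectangle is recorded by its columns, the form in which it
  is stripped.\<close>

definition split_durfee :: "nat \<Rightarrow> nat list \<Rightarrow> nat \<times> nat list \<times> nat list" where
  "split_durfee d xs =
     (let k = durfee d xs in (k, conjugate (rows_beside d k xs), drop k xs))"

definition join_durfee :: "nat \<Rightarrow> nat \<times> nat list \<times> nat list \<Rightarrow> nat list" where
  "join_durfee d = (\<lambda>(k, cs, bs).
     map ((+) (k + d)) (conjugate cs @ replicate (k - length (conjugate cs)) 0) @ bs)"

lemma rows_beside_in:
  assumes "sorted_wrt (\<ge>) xs"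
  shows "\<exists>j. rows_beside d k xs \<in> parts_upto j" "length (rows_beside d k xs) \<le> k"
proof -
  have "sorted_wrt (\<ge>) (take k xs)" using assms by (rule sorted_wrt_take)
  then have "sorted_wrt (\<ge>) (rows_beside d k xs)"
    unfolding rows_beside_def
    by (intro sorted_wrt_filter) (auto simp: sorted_wrt_map elim: sorted_wrt_mono_rel[rotated])
  moreover have "set (rows_beside d k xs) \<subseteq> {1..Max (set (rows_beside d k xs))}"
    by (auto simp: Suc_le_eq) (auto simp: rows_beside_def)
  ultimately show "\<exists>j. rows_beside d k xs \<in> parts_upto j" unfolding parts_upto_def by blast
  show "length (rows_beside d k xs) \<le> k"
    unfolding rows_beside_def by (rule le_trans[OF length_filter_le]) simp
qed

lemma split_durfee_in:
  assumes "xs \<in> all_partitions"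
  shows "split_durfee d xs \<in> (SIGMA k:UNIV. parts_upto k \<times> parts_upto (k + d))"
proof -
  have sorted: "sorted_wrt (\<ge>) xs" using assms by (simp add: all_partitions_def)
  let ?k = "durfee d xs"
  obtain j where "rows_beside d ?k xs \<in> parts_upto j" using rows_beside_in[OF sorted] by blast
  then have "conjugate (rows_beside d ?k xs) \<in> parts_upto ?k"
    using conjugate_in_parts_upto rows_beside_in(2)[OF sorted] parts_upto_mono by blast
  moreover have "drop ?k xs \<in> parts_upto (?k + d)"
    using assms durfee_maximal(3)[OF sorted, of _ d]
    by (auto simp: parts_upto_def all_partitions_def sorted_wrt_drop Suc_le_eq dest: in_set_dropD)
  ultimately show ?thesis by (simp add: split_durfee_def Let_def)
qed

lemma join_split_durfee:
  assumes "xs \<in> all_partitions"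
  shows "join_durfee d (split_durfee d xs) = xs"
proof -
  let ?k = "durfee d xs" let ?as = "map (\<lambda>x. x - (?k + d)) (take ?k xs)"
  have sorted: "sorted_wrt (\<ge>) xs" using assms by (simp add: all_partitions_def)
  have conj: "conjugate (conjugate (rows_beside d ?k xs)) = rows_beside d ?k xs"
    using rows_beside_in[OF sorted] conjugate_conjugate by blast
  have "sorted_wrt (\<ge>) (take ?k xs)" using sorted by (rule sorted_wrt_take)
  then have "sorted_wrt (\<ge>) ?as"
    by (auto simp: sorted_wrt_map elim: sorted_wrt_mono_rel[rotated])
  from filter_pos_sorted[OF this]
  have "rows_beside d ?k xs @ replicate (?k - length (rows_beside d ?k xs)) 0 = ?as"
    using durfee_maximal(1)[OF sorted, of d] by (simp add: rows_beside_def min_absorb2)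
  moreover have "map ((+) (?k + d)) ?as = take ?k xs"
    using durfee_maximal(2)[OF sorted, of _ d] by (auto intro!: map_idI)
  ultimately show ?thesis
    unfolding join_durfee_def split_durfee_def Let_def by (simp only: prod.case conj append_take_drop_id)
qed

lemma join_durfee_correct:
  assumes "cs \<in> parts_upto k" "bs \<in> parts_upto (k + d)" "0 < d"
  shows "join_durfee d (k, cs, bs) \<in> all_partitions"
    and "split_durfee d (join_durfee d (k, cs, bs)) = (k, cs, bs)"
    and "sum_list (join_durfee d (k, cs, bs)) = k * (k + d) + sum_list cs + sum_list bs"
proof -
  let ?as = "conjugate cs @ replicate (k - length (conjugate cs)) 0"
  let ?top = "map ((+) (k + d)) ?as" let ?xs = "join_durfee d (k, cs, bs)"
  have xs: "?xs = ?top @ bs" by (simp add: join_durfee_def)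
  have len: "length (conjugate cs) \<le> k" by (rule length_conjugate_le[OF assms(1)])
  have conj: "conjugate cs \<in> parts_upto (length cs)" by (rule conjugate_in_parts_upto[OF assms(1)])
  have top: "k + d \<le> x" if "x \<in> set ?top" for x using that by auto
  have bs: "x \<le> k + d" "0 < x" if "x \<in> set bs" for x using that assms(2) by (auto simp: parts_upto_def)
  have "sorted_wrt (\<ge>) ?as"
    using conj by (auto simp: sorted_wrt_append parts_upto_def sorted_wrt_replicate)
  then have "sorted_wrt (\<ge>) ?top" by (simp only: sorted_wrt_map) simp
  moreover have "sorted_wrt (\<ge>) bs" using assms(2) by (simp add: parts_upto_def)
  moreover have "0 < x" if "x \<in> set ?top \<union> set bs" for x
    using that top bs(2) assms(3) by fastforce
  moreover have "y \<le> x" if "x \<in> set ?top" "y \<in> set bs" for x y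
    using top[OF that(1)] bs(1)[OF that(2)] by simp
  ultimately show "?xs \<in> all_partitions"
    unfolding xs all_partitions_def sorted_wrt_append mem_Collect_eq set_append by blast
  have ltop: "length ?top = k" using len by simp
  have take: "take k ?xs = ?top" "drop k ?xs = bs" unfolding xs using ltop by simp_all
  have "durfee d ?xs = k"
    using ltop top bs(1) by (intro durfee_eqI) (simp_all only: take, simp_all add: xs)
  moreover have "rows_beside d k ?xs = conjugate cs"
    using conj unfolding rows_beside_def take by (auto simp: comp_def parts_upto_def filter_id_conv)
  ultimately show "split_durfee d ?xs = (k, cs, bs)"
    using conjugate_conjugate[OF assms(1)] take by (simp add: split_durfee_def)
  have "sum_list (map ((+) t) ys) = length ys * t + sum_list ys" for t and ys :: "nat list"
    by (induction ys) auto
  then have "sum_list ?top = length ?as * (k + d) + sum_list ?as" by this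
  also have "length ?as = k" using ltop by (simp only: length_map)
  also have "sum_list ?as = sum_list cs"
    using sum_conjugate[OF assms(1)] by (simp add: sum_list_replicate)
  finally show "sum_list ?xs = k * (k + d) + sum_list cs + sum_list bs"
    unfolding xs by (simp only: sum_list_append)
qed

lemma bij_betw_split_durfee:
  assumes "0 < d"
  shows "bij_betw (split_durfee d) all_partitions (SIGMA k:UNIV. parts_upto k \<times> parts_upto (k + d))"
proof (rule bij_betw_byWitness[where f' = "join_durfee d"])
  show "\<forall>xs\<in>all_partitions. join_durfee d (split_durfee d xs) = xs"
    using join_split_durfee by blast
  show "\<forall>t\<in>(SIGMA k:UNIV. parts_upto k \<times> parts_upto (k + d)). split_durfee d (join_durfee d t) = t"
    using join_durfee_correct(2)[OF _ _ assms] by (auto simp del: One_nat_def)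
  show "split_durfee d ` all_partitions \<subseteq> (SIGMA k:UNIV. parts_upto k \<times> parts_upto (k + d))"
    using split_durfee_in by blast
  show "join_durfee d ` (SIGMA k:UNIV. parts_upto k \<times> parts_upto (k + d)) \<subseteq> all_partitions"
  proof (rule image_subsetI)
    fix t assume "t \<in> (SIGMA k:UNIV. parts_upto k \<times> parts_upto (k + d))"
    then obtain k cs bs where "t = (k, cs, bs)" "cs \<in> parts_upto k" "bs \<in> parts_upto (k + d)" by blast
    then show "join_durfee d t \<in> all_partitions" using join_durfee_correct(1) assms by blast
  qed
qed

section \<open>Coding a partition by its rectangle, residue and hooks\<close>

text \<open>A code consists of the height \<open>k\<close> of the rectangle, the Frobenius symbol of the residue in the
  \<open>k\<close> by \<open>k + d\<close> box, and the partition formed by the hook lengths and the parts below the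
  rectangle.\<close>

definition durfee_codes :: "nat \<Rightarrow> (nat \<times> (nat \<times> nat) list \<times> nat list) set" where
  "durfee_codes d = (SIGMA k:UNIV. frobenius_symbols (k + d) k \<times> parts_upto (2 * k + d))"

definition durfee_code :: "nat \<Rightarrow> nat list \<Rightarrow> nat \<times> (nat \<times> nat) list \<times> nat list" where
  "durfee_code d xs =
     (case split_durfee d xs of (k, cs, bs) \<Rightarrow>
        case strip (k + d) cs of (ws, hs) \<Rightarrow> (k, frobenius ws, map ((+) (k + d)) hs @ bs))"

definition code_size :: "nat \<Rightarrow> nat \<times> (nat \<times> nat) list \<times> nat list \<Rightarrow> nat" where
  "code_size d = (\<lambda>(k, fs, cs). k * (k + d) + frobenius_size fs + sum_list cs)"

lemma bij_betw_Sigma: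
  assumes "\<And>i. i \<in> I \<Longrightarrow> bij_betw (f i) (A i) (B i)"
  shows "bij_betw (\<lambda>(i, x). (i, f i x)) (SIGMA i:I. A i) (SIGMA i:I. B i)"
proof (rule bij_betwI')
  fix p q assume "p \<in> (SIGMA i:I. A i)" "q \<in> (SIGMA i:I. A i)"
  then obtain i x j y where "p = (i, x)" "q = (j, y)" "i \<in> I" "x \<in> A i" "j \<in> I" "y \<in> A j" by blast
  then show "((\<lambda>(i, x). (i, f i x)) p = (\<lambda>(i, x). (i, f i x)) q) = (p = q)"
    using assms[of i] by (auto simp: bij_betw_def inj_on_def)
next
  fix p assume "p \<in> (SIGMA i:I. A i)"
  then show "(\<lambda>(i, x). (i, f i x)) p \<in> (SIGMA i:I. B i)"
    using bij_betwE[OF assms] by auto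
next
  fix q assume "q \<in> (SIGMA i:I. B i)"
  then obtain i y where q: "q = (i, y)" "i \<in> I" "y \<in> B i" by blast
  then obtain x where "x \<in> A i" "y = f i x"
    using assms[of i] by (auto simp: bij_betw_def)
  with q show "\<exists>p\<in>(SIGMA i:I. A i). q = (\<lambda>(i, x). (i, f i x)) p"
    by (intro bexI[of _ "(i, x)"]) auto
qed

lemma bij_betw_strip_merge:
  assumes "0 < l"
  shows "bij_betw (\<lambda>(cs, bs). case strip l cs of (ws, hs) \<Rightarrow> (frobenius ws, map ((+) l) hs @ bs))
    (parts_upto k \<times> parts_upto l) (frobenius_symbols l k \<times> parts_upto (l + k))"
proof -
  let ?regroup = "\<lambda>((ws :: nat list, hs :: nat list), bs :: nat list). (ws, (bs, hs))"
  let ?merge = "\<lambda>(bs, hs). map ((+) l) hs @ bs"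
  have "bij_betw (map_prod (strip l) id) (parts_upto k \<times> parts_upto l)
      ((box l k \<times> parts_upto k) \<times> parts_upto l)"
    by (rule bij_betw_map_prod[OF bij_betw_strip[OF assms] bij_betw_id])
  moreover have "bij_betw ?regroup ((box l k \<times> parts_upto k) \<times> parts_upto l)
      (box l k \<times> (parts_upto l \<times> parts_upto k))"
    by (rule bij_betw_byWitness[where f' = "\<lambda>(ws, (bs, hs)). ((ws, hs), bs)"]) auto
  moreover have "bij_betw (map_prod frobenius ?merge) (box l k \<times> (parts_upto l \<times> parts_upto k))
      (frobenius_symbols l k \<times> parts_upto (l + k))"
    by (rule bij_betw_map_prod[OF bij_betw_frobenius bij_betw_merge])
  ultimately have "bij_betw (map_prod frobenius ?merge \<circ> (?regroup \<circ> map_prod (strip l) id))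
      (parts_upto k \<times> parts_upto l) (frobenius_symbols l k \<times> parts_upto (l + k))"
    by (intro bij_betw_trans)
  moreover have "map_prod frobenius ?merge \<circ> (?regroup \<circ> map_prod (strip l) id) =
      (\<lambda>(cs, bs). case strip l cs of (ws, hs) \<Rightarrow> (frobenius ws, map ((+) l) hs @ bs))"
    by (auto simp: fun_eq_iff split: prod.splits)
  ultimately show ?thesis by simp
qed

text \<open>A bijective form of the identity
  \<open>q^(k(k + d)) / ((q)\<^sub>k (q)\<^sub>k\<^sub>+\<^sub>d) = q^(k(k + d)) binom\<^sub>q(2k + d, k) / (q)\<^sub>2\<^sub>k\<^sub>+\<^sub>d\<close>, summed over \<open>k\<close>.\<close>

lemma bij_betw_durfee_code:
  assumes "0 < d" shows "bij_betw (durfee_code d) all_partitions (durfee_codes d)"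
proof -
  let ?f = "\<lambda>k (cs, bs). case strip (k + d) cs of (ws, hs) \<Rightarrow> (frobenius ws, map ((+) (k + d)) hs @ bs)"
  have "bij_betw (?f k) (parts_upto k \<times> parts_upto (k + d))
      (frobenius_symbols (k + d) k \<times> parts_upto (2 * k + d))" for k
  proof -
    have "k + d + k = 2 * k + d" by simp
    then show ?thesis using bij_betw_strip_merge[of "k + d" k] assms by (simp only: add_pos_pos add_nonneg_pos)
  qed
  then have "bij_betw (\<lambda>(k, p). (k, ?f k p)) (SIGMA k:UNIV. parts_upto k \<times> parts_upto (k + d)) (durfee_codes d)"
    unfolding durfee_codes_def by (rule bij_betw_Sigma)
  from bij_betw_trans[OF bij_betw_split_durfee[OF assms] this] show ?thesis
    by (rule bij_betw_cong[THEN iffD1, rotated]) (auto simp: durfee_code_def split: prod.splits)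
qed

lemma code_size_durfee_code:
  assumes "xs \<in> all_partitions" "0 < d"
  shows "code_size d (durfee_code d xs) = sum_list xs"
proof -
  obtain k cs bs where s: "split_durfee d xs = (k, cs, bs)" by (cases "split_durfee d xs") auto
  obtain ws hs where st: "strip (k + d) cs = (ws, hs)" by fastforce
  have mem: "cs \<in> parts_upto k" "bs \<in> parts_upto (k + d)"
    using split_durfee_in[OF assms(1), of d] s by auto
  have ws: "ws \<in> box (k + d) k" using strip_in[OF _ mem(1), of "k + d"] st assms(2) by auto
  have "sum_list (map ((+) t) ys) = t * length ys + sum_list ys" for t and ys :: "nat list"
    by (induction ys) auto
  moreover have "sum_list cs = sum_list ws + sum_list hs + (k + d) * length hs"
    using sum_strip[OF _ mem(1) st] assms(2) by simp
  moreover have "sum_list xs = k * (k + d) + sum_list cs + sum_list bs"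
    using join_durfee_correct(3)[OF mem assms(2)] join_split_durfee[OF assms(1), of d] s by simp
  ultimately show ?thesis
    using frobenius_size[OF ws] by (simp add: durfee_code_def s st code_size_def)
qed

lemma le_rerank_iff_reaches:
  assumes "xs \<in> all_partitions"
  shows "int r \<le> rerank xs \<longleftrightarrow> (case durfee_code 1 xs of (k, fs, cs) \<Rightarrow> reaches r k fs)"
proof -
  have sorted: "sorted_wrt (\<ge>) xs" using assms by (simp add: all_partitions_def)
  let ?k = "n1 xs"
  obtain ws hs where st: "strip (?k + 1) (conjugate (A1 xs)) = (ws, hs)" by fastforce
  obtain j where j: "A1 xs \<in> parts_upto j"
    using rows_beside_in[OF sorted] unfolding A1_eq_rows_beside by blast
  have s: "split_durfee 1 xs = (?k, conjugate (A1 xs), drop ?k xs)"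
    unfolding split_durfee_def Let_def n1_eq_durfee[symmetric] A1_eq_rows_beside ..
  then have "conjugate (A1 xs) \<in> parts_upto ?k"
    using split_durfee_in[OF assms, of 1] by auto
  then have "ws \<in> box (?k + 1) ?k" using strip_in[of "?k + 1"] st by fastforce
  moreover have "R1 xs = column_diagram ws" using R1_eq[OF j] st by simp
  ultimately have "int r \<le> rerank xs \<longleftrightarrow> reaches r ?k (frobenius ws)"
    by (intro le_rerank_iff)
  then show ?thesis unfolding durfee_code_def s prod.case st .
qed

section \<open>Partitions with large rerank\<close>

text \<open>For \<open>k' = k - r\<close> and \<open>d' = 2 * r + 1\<close> the sum \<open>2 * k' + d'\<close> is again \<open>2 * k + 1\<close>, and the
  \<open>k'\<close> by \<open>k' + d'\<close> box is the one that contains the reflected symbols. So a reflected code is a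
  code for rectangles with the larger difference of side lengths.\<close>

lemma bij_betw_reflect_code:
  "bij_betw (\<lambda>(k, fs, cs). (k - r, reflect r k fs, cs))
     {(k, fs, cs) \<in> durfee_codes 1. reaches r k fs} (durfee_codes (2 * r + 1))"
proof (rule bij_betw_byWitness[where f' = "\<lambda>(k, fs, cs). (k + r, unreflect r (k + r) fs, cs)"])
  let ?f = "\<lambda>(k, fs, cs). (k - r, reflect r k fs, cs)"
  let ?g = "\<lambda>(k, fs, cs). (k + r, unreflect r (k + r) fs, cs)"
  have f: "?f (k, fs, cs) \<in> durfee_codes (2 * r + 1) \<and> ?g (?f (k, fs, cs)) = (k, fs, cs)"
    if "(k, fs, cs) \<in> durfee_codes 1" "reaches r k fs" for k fs cs
  proof -
    from that have fs: "fs \<in> frobenius_symbols (k + 1) k" and cs: "cs \<in> parts_upto (2 * k + 1)"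
      by (auto simp: durfee_codes_def)
    note le = reaches_le[OF fs that(2)]
    have "k - r + (2 * r + 1) = k + 1 + r" "2 * (k - r) + (2 * r + 1) = 2 * k + 1" using le by auto
    moreover have "k \<le> k + 1 + r" by simp
    ultimately show ?thesis using reflect_correct[OF fs that(2)] cs le by (simp add: durfee_codes_def add.commute)
  qed
  have g: "?g (k, fs, cs) \<in> durfee_codes 1 \<and> reaches r (k + r) (unreflect r (k + r) fs) \<and>
      ?f (?g (k, fs, cs)) = (k, fs, cs)"
    if "(k, fs, cs) \<in> durfee_codes (2 * r + 1)" for k fs cs
  proof -
    have eqs: "k + (2 * r + 1) = k + r + 1 + r" "2 * k + (2 * r + 1) = 2 * (k + r) + 1" by auto
    from that have *: "fs \<in> frobenius_symbols (k + (2 * r + 1)) k" "cs \<in> parts_upto (2 * k + (2 * r + 1))"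
      unfolding durfee_codes_def by blast+
    have fs: "fs \<in> frobenius_symbols (k + r + 1 + r) (k + r - r)"
      using *(1) unfolding eqs by simp
    have cs: "cs \<in> parts_upto (2 * (k + r) + 1)"
      using *(2) unfolding eqs .
    show ?thesis using unreflect_correct[OF fs] cs *(1) by (simp add: durfee_codes_def)
  qed
  show "\<forall>a\<in>{(k, fs, cs) \<in> durfee_codes 1. reaches r k fs}. ?g (?f a) = a" using f by blast
  show "\<forall>a\<in>durfee_codes (2 * r + 1). ?f (?g a) = a" using g by (metis (no_types, lifting) prod_cases3)
  show "?f ` {(k, fs, cs) \<in> durfee_codes 1. reaches r k fs} \<subseteq> durfee_codes (2 * r + 1)" using f by blast
  show "?g ` durfee_codes (2 * r + 1) \<subseteq> {(k, fs, cs) \<in> durfee_codes 1. reaches r k fs}"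
  proof (rule image_subsetI)
    fix a assume "a \<in> durfee_codes (2 * r + 1)"
    then show "?g a \<in> {(k, fs, cs) \<in> durfee_codes 1. reaches r k fs}" using g by (cases a) auto
  qed
qed

text \<open>Reflection keeps the size of the residue, and \<open>k (k + 1) - (k - r) (k + r + 1) = r (r + 1)\<close>.\<close>

lemma code_size_reflect:
  assumes "(k, fs, cs) \<in> durfee_codes 1" "reaches r k fs"
  shows "code_size 1 (k, fs, cs) = code_size (2 * r + 1) (k - r, reflect r k fs, cs) + r * (r + 1)"
proof -
  from assms(1) have fs: "fs \<in> frobenius_symbols (k + 1) k" by (auto simp: durfee_codes_def)
  \<comment> \<open>Rewriting \<open>k\<close> as a sum removes the truncated difference \<open>k - r\<close>.\<close>
  obtain j where "k = r + j" using reaches_le[OF fs assms(2)] le_Suc_ex by blast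
  then show ?thesis using reflect_correct[OF fs assms(2)] by (simp add: code_size_def algebra_simps)
qed

lemma card_Collect_bij_betw:
  assumes "bij_betw f A B" "\<And>x. x \<in> A \<Longrightarrow> P x \<longleftrightarrow> Q (f x)"
  shows "card {x \<in> A. P x} = card {y \<in> B. Q y}"
proof (rule bij_betw_same_card[of f])
  have "f ` {x \<in> A. P x} = {y \<in> B. Q y}"
    using assms bij_betw_imp_surj_on[OF assms(1)] by auto
  then show "bij_betw f {x \<in> A. P x} {y \<in> B. Q y}"
    by (intro bij_betw_subset[OF assms(1)]) auto
qed

text \<open>Code with \<open>d = 1\<close>, reflect, and decode with \<open>d = 2 * r + 1\<close>.\<close>

lemma card_le_rerank:
  "card {xs \<in> partitions n. int r \<le> rerank xs} =
   card {xs \<in> all_partitions. sum_list xs + r * (r + 1) = n}"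
proof -
  let ?C = "{(k, fs, cs) \<in> durfee_codes 1. reaches r k fs}"
  have "card {xs \<in> partitions n. int r \<le> rerank xs} =
      card {xs \<in> all_partitions. sum_list xs = n \<and> int r \<le> rerank xs}"
    by (simp add: partitions_eq conj_assoc)
  also have "\<dots> = card {c \<in> durfee_codes 1. code_size 1 c = n \<and> (case c of (k, fs, cs) \<Rightarrow> reaches r k fs)}"
    by (rule card_Collect_bij_betw[OF bij_betw_durfee_code])
      (simp_all add: code_size_durfee_code le_rerank_iff_reaches del: One_nat_def)
  also have "\<dots> = card {c \<in> ?C. code_size 1 c = n}"
    by (rule arg_cong[of _ _ card]) auto
  also have "\<dots> = card {c \<in> durfee_codes (2 * r + 1). code_size (2 * r + 1) c + r * (r + 1) = n}"
    by (rule card_Collect_bij_betw[OF bij_betw_reflect_code])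
      (use code_size_reflect in \<open>force simp del: One_nat_def\<close>)
  also have "\<dots> = card {xs \<in> all_partitions. sum_list xs + r * (r + 1) = n}"
    by (rule card_Collect_bij_betw[OF bij_betw_durfee_code, symmetric])
      (simp_all only: code_size_durfee_code zero_less_Suc add_Suc_right add_0_right One_nat_def)
  finally show ?thesis .
qed

section \<open>Partitions with large minimal excludant\<close>

lemma mex22_properties: "0 < mex22 xs" "even (mex22 xs)" "mex22 xs \<notin> set xs"
proof -
  have "2 * Suc (sum_list xs) \<notin> set xs" using member_le_sum_list[of _ xs] by fastforce
  then have "0 < 2 * Suc (sum_list xs) \<and> even (2 * Suc (sum_list xs)) \<and> 2 * Suc (sum_list xs) \<notin> set xs"
    by simp
  then have "0 < mex22 xs \<and> even (mex22 xs) \<and> mex22 xs \<notin> set xs"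
    unfolding mex22_def by (rule LeastI)
  then show "0 < mex22 xs" "even (mex22 xs)" "mex22 xs \<notin> set xs" by auto
qed

lemma le_mex22_iff: "2 * r + 2 \<le> mex22 xs \<longleftrightarrow> (\<forall>i\<in>{1..r}. 2 * i \<in> set xs)"
proof
  assume le: "2 * r + 2 \<le> mex22 xs"
  show "\<forall>i\<in>{1..r}. 2 * i \<in> set xs"
  proof (intro ballI, rule ccontr)
    fix i assume i: "i \<in> {1..r}" "2 * i \<notin> set xs"
    then have "mex22 xs \<le> 2 * i" unfolding mex22_def by (intro Least_le) auto
    with i le show False by auto
  qed
next
  assume *: "\<forall>i\<in>{1..r}. 2 * i \<in> set xs"
  obtain i where i: "mex22 xs = 2 * i" using mex22_properties(2) by blast
  with mex22_properties(1,3)[of xs] * have "i \<notin> {1..r}" "0 < i" by auto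
  with i show "2 * r + 2 \<le> mex22 xs" by auto
qed

definition evens :: "nat \<Rightarrow> nat multiset" where
  "evens r = image_mset ((*) 2) (mset_set {1..r})"

lemma evens_subset_iff: "evens r \<subseteq># mset xs \<longleftrightarrow> (\<forall>i\<in>{1..r}. 2 * i \<in> set xs)"
proof -
  have "evens r = mset_set ((*) 2 ` {1..r})"
    unfolding evens_def by (rule image_mset_mset_set) (simp add: inj_on_def)
  moreover have "mset_set A \<subseteq># mset xs \<longleftrightarrow> A \<subseteq> set xs" if "finite A" for A
    using that by (metis finite_set_mset mset_set_set_mset_msubset msubset_mset_set_iff set_mset_mset
        set_mset_mono finite_set_mset_mset_set subset_mset.order_trans)
  ultimately show ?thesis by auto
qed

lemma sum_evens: "sum_mset (evens r) = r * (r + 1)"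
  by (induction r) (auto simp: evens_def atLeastAtMostSuc_conv)

definition decreasing_list :: "nat multiset \<Rightarrow> nat list" where
  "decreasing_list M = rev (sorted_list_of_multiset M)"

lemma mset_decreasing_list [simp]: "mset (decreasing_list M) = M"
  by (simp add: decreasing_list_def)

lemma decreasing_list_in: "0 \<notin># M \<Longrightarrow> decreasing_list M \<in> all_partitions"
  by (auto simp: decreasing_list_def all_partitions_def sorted_wrt_rev intro!: gr0I)

lemma decreasing_list_mset: "xs \<in> all_partitions \<Longrightarrow> decreasing_list (mset xs) = xs"
proof -
  assume "xs \<in> all_partitions"
  then have "sorted (rev xs)" by (simp add: all_partitions_def sorted_wrt_rev)
  then have "sorted_list_of_multiset (mset (rev xs)) = rev xs"
    by (simp add: sorted_sort_id del: mset_rev)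
  then show ?thesis by (simp add: decreasing_list_def)
qed

text \<open>One copy of each of the numbers \<open>2, 4, \<dots>, 2 * r\<close> can be taken away or added back; their sum
  is \<open>r * (r + 1)\<close>.\<close>

lemma card_le_mex22:
  "card {xs \<in> partitions n. 2 * r + 2 \<le> mex22 xs} =
   card {xs \<in> all_partitions. sum_list xs + r * (r + 1) = n}"
proof (rule bij_betw_same_card[OF bij_betw_byWitness[where
      f = "\<lambda>xs. decreasing_list (mset xs - evens r)" and
      f' = "\<lambda>xs. decreasing_list (mset xs + evens r)"]])
  let ?A = "{xs \<in> partitions n. 2 * r + 2 \<le> mex22 xs}"
  let ?B = "{xs \<in> all_partitions. sum_list xs + r * (r + 1) = n}"
  let ?f = "\<lambda>xs. decreasing_list (mset xs - evens r)"
  let ?g = "\<lambda>xs. decreasing_list (mset xs + evens r)"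
  have A: "evens r \<subseteq># mset xs" "xs \<in> all_partitions" "sum_list xs = n" if "xs \<in> ?A" for xs
    using that unfolding mem_Collect_eq le_mex22_iff evens_subset_iff partitions_eq by blast+
  have pos: "0 \<notin># mset xs" if "xs \<in> all_partitions" for xs
    using that by (auto simp: all_partitions_def)
  have sum: "sum_list (decreasing_list M) = sum_mset M" for M
    using sum_mset_sum_list[of "decreasing_list M"] by simp
  show "\<forall>xs\<in>?A. ?g (?f xs) = xs"
    using A by (simp add: decreasing_list_mset)
  show "\<forall>ys\<in>?B. ?f (?g ys) = ys"
    by (simp add: decreasing_list_mset)
  show "?f ` ?A \<subseteq> ?B"
  proof (rule image_subsetI)
    fix xs assume xs: "xs \<in> ?A"
    have "0 \<notin># mset xs - evens r" using pos[OF A(2)[OF xs]] by (meson in_diffD)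
    moreover have "sum_mset (mset xs - evens r) + sum_mset (evens r) = n"
      using A(1,3)[OF xs] by (simp flip: sum_mset.union add: sum_mset_sum_list)
    ultimately show "?f xs \<in> ?B" by (simp add: decreasing_list_in sum sum_evens)
  qed
  show "?g ` ?B \<subseteq> ?A"
  proof (rule image_subsetI)
    fix ys assume ys: "ys \<in> ?B"
    have "0 \<notin># mset ys + evens r" using ys pos[of ys] by (auto simp: evens_def)
    moreover have "sum_mset (mset ys + evens r) = n"
      using ys by (simp add: sum_evens sum_mset_sum_list)
    moreover have "evens r \<subseteq># mset (?g ys)" by simp
    ultimately show "?g ys \<in> ?A"
      unfolding evens_subset_iff mem_Collect_eq le_mex22_iff partitions_eq
      by (intro conjI decreasing_list_in) (assumption | simp only: sum)+
  qed
qed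

section \<open>Comparing the two statistics\<close>

lemma finite_partitions: "finite (partitions n)"
proof (rule finite_subset[OF _ finite_lists_length_le])
  have len: "length xs \<le> sum_list xs" if "\<forall>x\<in>set xs. 0 < x" for xs :: "nat list"
    using that by (induction xs) auto
  show "partitions n \<subseteq> {xs. set xs \<subseteq> {..n} \<and> length xs \<le> n}"
    using len member_le_sum_list by (fastforce simp: partitions_def)
qed simp

text \<open>Equal tails give equally many elements on every level \<open>r\<close>, as a difference of two tails,
  and \<open>P\<close> selects a set of levels.\<close>

lemma card_eq_if_tails_equidistributed:
  fixes s t :: "'a \<Rightarrow> nat"
  assumes "finite A" and tails: "\<And>r. card {x \<in> A. r \<le> s x} = card {x \<in> A. r \<le> t x}"
  shows "card {x \<in> A. P (s x)} = card {x \<in> A. P (t x)}"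
proof -
  have level: "card {x \<in> A. f x = r} = card {x \<in> A. r \<le> f x} - card {x \<in> A. Suc r \<le> f x}"
    for f :: "'a \<Rightarrow> nat" and r
  proof -
    have "{x \<in> A. f x = r} = {x \<in> A. r \<le> f x} - {x \<in> A. Suc r \<le> f x}" by auto
    then show ?thesis using assms(1) by (simp add: card_Diff_subset Collect_mono_iff)
  qed
  have group: "card {x \<in> A. P (f x)} = (\<Sum>r\<in>s ` A \<union> t ` A. if P r then card {x \<in> A. f x = r} else 0)"
    if "f ` A \<subseteq> s ` A \<union> t ` A" for f
  proof -
    have "card {x \<in> A. P (f x)} = (\<Sum>x\<in>A. if P (f x) then 1 else 0)"
      using assms(1) by (simp add: sum.If_cases Int_def)
    also have "\<dots> = (\<Sum>r\<in>s ` A \<union> t ` A. \<Sum>x\<in>{x \<in> A. f x = r}. if P (f x) then 1 else 0)"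
      by (rule sum.group[symmetric]) (use assms(1) that in auto)
    also have "\<dots> = (\<Sum>r\<in>s ` A \<union> t ` A. if P r then card {x \<in> A. f x = r} else 0)"
      by (rule sum.cong) auto
    finally show ?thesis .
  qed
  have "card {x \<in> A. s x = r} = card {x \<in> A. t x = r}" for r
    unfolding level[of s] level[of t] tails ..
  then show ?thesis using group[of s] group[of t] by (simp cong: if_cong)
qed

text \<open>For \<open>r = 0\<close> both sides of \<open>card_le_rerank\<close> range over the partitions of \<open>n\<close>, so the
  finite subset of those with nonnegative rerank has full size.\<close>

lemma rerank_nonneg:
  assumes "xs \<in> partitions n" shows "0 \<le> rerank xs"
proof -
  have "card {xs \<in> partitions n. int 0 \<le> rerank xs} = card (partitions n)"
    unfolding card_le_rerank by (simp add: partitions_eq)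
  then have "{xs \<in> partitions n. int 0 \<le> rerank xs} = partitions n"
    by (intro card_subset_eq finite_partitions) auto
  with assms show ?thesis by auto
qed

theorem corollary2:
  fixes n :: nat
  shows "p22 n = card {xs \<in> partitions n. even (rerank xs)}"
proof -
  let ?s = "\<lambda>xs. mex22 xs div 2 - 1" and ?t = "\<lambda>xs. nat (rerank xs)"
  have s: "r \<le> ?s xs \<longleftrightarrow> 2 * r + 2 \<le> mex22 xs" "mex22 xs mod 4 = 2 \<longleftrightarrow> even (?s xs)" for r xs
  proof -
    obtain i where i: "mex22 xs = 2 * Suc i" using mex22_properties(1,2)[of xs] by (metis dvdE gr0_implies_Suc mult_0_right neq0_conv)
    then show "r \<le> ?s xs \<longleftrightarrow> 2 * r + 2 \<le> mex22 xs" by simp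
    have "2 * Suc i mod 4 = 2 \<longleftrightarrow> even i" by presburger
    then show "mex22 xs mod 4 = 2 \<longleftrightarrow> even (?s xs)" using i by simp
  qed
  have t: "r \<le> ?t xs \<longleftrightarrow> int r \<le> rerank xs" "even (rerank xs) \<longleftrightarrow> even (?t xs)"
    if "xs \<in> partitions n" for r xs
    using rerank_nonneg[OF that] by (auto simp: even_nat_iff)
  have "p22 n = card {xs \<in> partitions n. even (?s xs)}"
    unfolding p22_def s(2) ..
  also have "\<dots> = card {xs \<in> partitions n. even (?t xs)}"
  proof (rule card_eq_if_tails_equidistributed[OF finite_partitions])
    fix r
    have "{xs \<in> partitions n. r \<le> ?t xs} = {xs \<in> partitions n. int r \<le> rerank xs}"
      using t(1) by blast
    then show "card {xs \<in> partitions n. r \<le> ?s xs} = card {xs \<in> partitions n. r \<le> ?t xs}"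
      unfolding s(1) by (simp only: card_le_mex22 card_le_rerank)
  qed
  also have "{xs \<in> partitions n. even (?t xs)} = {xs \<in> partitions n. even (rerank xs)}"
    using t(2) by blast
  finally show ?thesis .
qed

end
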